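(* Fix an iteration $k$ and a state $s$, and suppose that the conditional moments below are finite. Then, for every $t<1$ and every $y$, as $\lambda^{-1}\to0$, $$\bar b_{k+1}(y,t;s)-b_k(y,t;s)=\frac1{\lambda(1-t)}\operatorname{Cov}_{\mathbb P_k^s}\big(Y_1,\widehat A_k(s,Y_1)\mid Y_t=y\big)+O(\lambda^{-2}).$$ Whenever differentiation under the conditional expectation is valid, $$\bar b_{k+1}(y,t;s)-b_k(y,t;s)=\frac1\lambda\nabla_y\,\mathbb E_{\mathbb P_k^s}\big[\widehat A_k(s,Y_1)\mid Y_t=y\big]+O(\lambda^{-2}).$$
   Context: $\pi_k(\cdot\mid s)$ is a probability measure on $\mathbb R^{d_{\mathcal A}}$, absolutely continuous with respect to $\gamma_{d_{\mathcal A}}=\mathcal N(0,I_{d_{\mathcal A}})$ with density ratio $f_{k,s}$. $\widehat A_k(s,\cdot)$ is a bounded real function (the estimated advantage, a difference of a bounded network output and an average of its values), not depending on $\lambda$. For $\lambda>0$, $\bar\pi_{k+1}(\mathrm da\mid s)=\pi_k(\mathrm da\mid s)e^{\widehat A_k(s,a)/\lambda}/\int e^{\widehat A_k(s,a')/\lambda}\pi_k(\mathrm da'\mid s)$, with Gaussian density ratio $\bar f_{k+1,s}=\mathrm d\bar\pi_{k+1}(\cdot\mid s)/\mathrm d\gamma_{d_{\mathcal A}}$. With the heat semigroup $Q_uf(x)=\mathbb E f(x+\sqrt uZ)$, $Z\sim\mathcal N(0,I_{d_{\mathcal A}})$, the Schrödinger--Föllmer drifts are $b_k(y,t;s)=\nabla_y\log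 Q_{1-t}f_{k,s}(y)$ and $\bar b_{k+1}(y,t;s)=\nabla_y\log Q_{1-t}\bar f_{k+1,s}(y)$. $\mathbb P_k^s$ is the path law of the reference process $\mathrm dY_t=b_k(Y_t,t;s)\mathrm dt+\mathrm dB_t$, $Y_0=0$, which has $Y_1\sim\pi_k(\cdot\mid s)$ and, conditionally on $Y_1=a$, is a Brownian bridge from $0$ to $a$. *)

theory Defs
  imports "HOL-Probability.Probability" "HOL-Library.Landau_Symbols"
begin

(* Density of N(0, u I) with respect to lborel, for u > 0. *)
definition gauss_density :: "real \<Rightarrow> 'a::euclidean_space \<Rightarrow> real" where
  "gauss_density u x = (\<Prod>b\<in>Basis. normal_density 0 (sqrt u) (x \<bullet> b))"

definition std_gaussian :: "'a::euclidean_space measure" where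
  "std_gaussian = density lborel (\<lambda>x. ennreal (gauss_density 1 x))"

definition density_ratio :: "'a::euclidean_space measure \<Rightarrow> 'a \<Rightarrow> real" where
  "density_ratio \<mu> x = enn2real (RN_deriv std_gaussian \<mu> x)"

definition tilted_policy ::
  "'a::euclidean_space measure \<Rightarrow> ('a \<Rightarrow> real) \<Rightarrow> real \<Rightarrow> 'a measure" where
  "tilted_policy \<mu> A lam =
     density \<mu> (\<lambda>a. ennreal (exp (A a / lam) / (\<integral>a'. exp (A a' / lam) \<partial>\<mu>)))"

definition heat :: "real \<Rightarrow> ('a::euclidean_space \<Rightarrow> real) \<Rightarrow> 'a \<Rightarrow> real" where
  "heat u f x = (\<integral>z. f (x + sqrt u *\<^sub>R z) \<partial>std_gaussian)"

(* Meaningful only where g is differentiable; the gradient is then unique. *)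
definition grad :: "('a::euclidean_space \<Rightarrow> real) \<Rightarrow> 'a \<Rightarrow> 'a" where
  "grad g y = (THE D. GDERIV g y :> D)"

definition sf_drift :: "('a::euclidean_space \<Rightarrow> real) \<Rightarrow> 'a \<Rightarrow> real \<Rightarrow> 'a" where
  "sf_drift f y t = grad (\<lambda>x. ln (heat (1 - t) f x)) y"

definition regular_cond_dist ::
  "'w measure \<Rightarrow> 'b measure \<Rightarrow> 'c measure \<Rightarrow> ('w \<Rightarrow> 'b) \<Rightarrow> ('w \<Rightarrow> 'c) \<Rightarrow> ('b \<Rightarrow> 'c measure) \<Rightarrow> bool"
where
  "regular_cond_dist M S N X Z \<kappa> \<longleftrightarrow>
     \<kappa> \<in> S \<rightarrow>\<^sub>M prob_algebra N \<and>
     (\<forall>B\<in>sets S. \<forall>C\<in>sets N.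
        emeasure M {w \<in> space M. X w \<in> B \<and> Z w \<in> C} =
        (\<integral>\<^sup>+x. emeasure (\<kappa> x) C * indicator B x \<partial>distr M S X))"

(* A regular conditional distribution is only determined almost everywhere. The conditional law
   at the point y is the value at y of a version that is weakly continuous at y; this value is
   unique as soon as y lies in the topological support of the law of X. *)
definition cond_law ::
  "'w measure \<Rightarrow> ('w \<Rightarrow> 'a::euclidean_space) \<Rightarrow> ('w \<Rightarrow> 'a) \<Rightarrow> 'a \<Rightarrow> 'a measure" where
  "cond_law M X Z y =
     (THE \<mu>. \<exists>\<kappa>. regular_cond_dist M borel borel X Z \<kappa> \<and> \<kappa> y = \<mu> \<and>
        (\<forall>g::'a \<Rightarrow> real. continuous_on UNIV g \<and> bounded (range g)
            \<longrightarrow> isCont (\<lambda>x. \<integral>a. g a \<partial>\<kappa> x) y))"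

(* Covariance of a vector (the identity) with a scalar function g. *)
definition cov_id :: "'a::euclidean_space measure \<Rightarrow> ('a \<Rightarrow> real) \<Rightarrow> 'a" where
  "cov_id \<mu> g = (\<integral>a. (g a - (\<integral>a'. g a' \<partial>\<mu>)) *\<^sub>R (a - (\<integral>a'. a' \<partial>\<mu>)) \<partial>\<mu>)"

abbreviation path_space :: "real \<Rightarrow> (real \<Rightarrow> 'a::euclidean_space) measure" where
  "path_space T \<equiv> PiM {0..T} (\<lambda>_. borel)"

(* Law on path_space 1 of a Brownian bridge from 0 to a: the joint density at times
   0 < \<tau> 1 < ... < \<tau> n < 1 is that of Brownian motion conditioned to be at a at time 1.
   The points z 0 = 0 and z (n+1) = a complete the vector of intermediate positions. *)
definition brownian_bridge_law :: "'a::euclidean_space \<Rightarrow> (real \<Rightarrow> 'a) measure \<Rightarrow> bool" where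
  "brownian_bridge_law a P \<longleftrightarrow>
     prob_space P \<and> sets P = sets (path_space 1) \<and>
     (AE w in P. w 0 = 0 \<and> w 1 = a) \<and>
     (\<forall>(n::nat) (\<tau>::nat \<Rightarrow> real).
        \<tau> 0 = 0 \<and> \<tau> (Suc n) = 1 \<and> (\<forall>i\<le>n. \<tau> i < \<tau> (Suc i)) \<longrightarrow>
        distributed P (PiM {1..n} (\<lambda>_. lborel)) (\<lambda>w. \<lambda>i\<in>{1..n}. w (\<tau> i))
          (\<lambda>x. let z = x(0 := 0, Suc n := a) in
             ennreal ((\<Prod>i\<le>n. gauss_density (\<tau> (Suc i) - \<tau> i) (z (Suc i) - z i))
                      / gauss_density 1 a)))"

(* Y is a weak solution on [0,1) of dY = b(Y,t) dt + dB, Y_0 = 0: the process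
   B t = Y t - (integral of b(Y r, r) over [0,t]) is a Brownian motion for the filtration
   generated by Y. No integrability of the drift up to time 1 itself is required. *)
definition sde_solution ::
  "'w measure \<Rightarrow> (real \<Rightarrow> 'w \<Rightarrow> 'a::euclidean_space) \<Rightarrow> ('a \<Rightarrow> real \<Rightarrow> 'a) \<Rightarrow> bool" where
  "sde_solution M Y b \<longleftrightarrow>
     (AE w in M. Y 0 w = 0) \<and>
     (\<forall>t\<in>{0..<1}. AE w in M. set_integrable lborel {0..t} (\<lambda>r. b (Y r w) r)) \<and>
     (let B = (\<lambda>t w. Y t w - (LINT r:{0..t}|lborel. b (Y r w) r)) in
      \<forall>s t. 0 \<le> s \<and> s < t \<and> t < 1 \<longrightarrow>
        distributed M lborel (\<lambda>w. B t w - B s w) (\<lambda>x. ennreal (gauss_density (t - s) x)) \<and>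
        prob_space.indep_set M
          (sets (vimage_algebra (space M) (\<lambda>w. \<lambda>r\<in>{0..s}. Y r w) (path_space s)))
          (sets (vimage_algebra (space M) (\<lambda>w. B t w - B s w) borel)))"

(* The reference (Schroedinger-Foellmer) process of \<mu>: it solves the SDE with the Foellmer
   drift of \<mu>, has terminal law \<mu>, and given Y 1 = a it is a Brownian bridge from 0 to a. *)
definition reference_process ::
  "'w measure \<Rightarrow> (real \<Rightarrow> 'w \<Rightarrow> 'a::euclidean_space) \<Rightarrow> 'a measure \<Rightarrow> bool" where
  "reference_process M Y \<mu> \<longleftrightarrow>
     prob_space M \<and>
     (\<forall>t\<in>{0..1}. Y t \<in> borel_measurable M) \<and>
     (\<forall>w\<in>space M. continuous_on {0..1} (\<lambda>t. Y t w)) \<and>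
     sde_solution M Y (sf_drift (density_ratio \<mu>)) \<and>
     distr M borel (Y 1) = \<mu> \<and>
     (\<exists>K. regular_cond_dist M borel (path_space 1) (Y 1) (\<lambda>w. \<lambda>t\<in>{0..1}. Y t w) K \<and>
          (AE a in \<mu>. brownian_bridge_law a (K a)))"

end

(*
Write p(x,a) for the density at x of the bridge position given endpoint a, divided by the N(0,tI)
density at x, and put u = 1 - t. Then Q_u f(x) is the integral of p(x,a) against pi_k(da), and the
conditional law of Y_1 given Y_t = x is p(x,a) pi_k(da) / Q_u f(x). In x, p is an exponential
family exp(<a - y, x - y> / u) up to a factor not depending on a, so both drifts at y are means of
X = (a - y) / u: under the conditional law nu for b_k, under its tilt by exp(A / lambda) for the
updated drift. Expanding the tilted mean to first order in 1 / lambda gives the covariance, and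
differentiating the quotient defining the conditional expectation gives the same covariance.
*)
theory Submission
  imports Defs
begin

text \<open>Two points go beyond the exponential-family identity. Differentiation under the integral
  at y needs an exponential moment of X under p(y,a) pi_k(da). For 0 < t < 1 the quotient of
  Gaussian densities decays like exp(-(1/u - 1) |a|^2 / 2) to leading order, so every probability
  measure qualifies. At t = 0 this decay is gone, and finiteness of Q_1 f near 0, tested along the
  coordinate axes, supplies the moment instead. Secondly, \<open>cond_law\<close> selects a value at
  a single point: the candidate has to be a regular conditional distribution that is weakly
  continuous at y, with y in the support of the law of Y_t. Weak continuity comes from the same
  differentiation, since E[g | Y_t = x] is a quotient of two integrals differentiable at y. At t = 0
  the law of Y_0 is the point mass at 0, so y = 0 is the only admissible point and the conditional
  law is pi_k itself. Boundedness of A makes the second-order remainder of exp(A / lambda) small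
  uniformly in a, which yields the O(lambda^-2) term with an explicit constant.\<close>

section \<open>Exponential estimates and the gradient of a Laplace transform at the origin\<close>

lemma exp_sub_one_sub_abs_le:
  fixes s :: real
  shows "\<bar>exp s - 1 - s\<bar> \<le> s\<^sup>2 * exp \<bar>s\<bar> / 2"
proof -
  obtain r where r: "\<bar>r\<bar> \<le> \<bar>s\<bar>"
    "exp s = (\<Sum>m<2. s ^ m / fact m) + exp r / fact 2 * s ^ 2"
    using Maclaurin_exp_le[of s 2] by blast
  then have "exp s - 1 - s = exp r * s\<^sup>2 / 2"
    by (simp add: numeral_2_eq_2)
  moreover have "exp r \<le> exp \<bar>s\<bar>" using r(1) by simp
  then have "exp r * s\<^sup>2 \<le> exp \<bar>s\<bar> * s\<^sup>2" by (intro mult_right_mono) auto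
  moreover have "0 \<le> exp r * s\<^sup>2" by simp
  ultimately show ?thesis unfolding abs_le_iff by (simp only: mult.commute) linarith
qed

lemma norm_integral_le_integral:
  fixes f :: "'b \<Rightarrow> 'c::{banach,second_countable_topology}"
  assumes "integrable M f" "integrable M g" "\<And>x. norm (f x) \<le> g x"
  shows "norm (\<integral>x. f x \<partial>M) \<le> (\<integral>x. g x \<partial>M)"
  by (rule order_trans[OF integral_norm_bound integral_mono]) (use assms in auto)

text \<open>Serves, like \<open>le_exp_mult\<close> below, to absorb the polynomial factors of
  Taylor terms into an exponential moment.\<close>

lemma power2_le_exp:
  fixes r :: real
  assumes "0 \<le> r"
  shows "r\<^sup>2 \<le> 2 * exp r"
proof -
  have "1 + r + r\<^sup>2 / 2 \<le> exp r"
    using exp_lower_Taylor_quadratic[OF assms] by simp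
  then show ?thesis using assms by simp
qed

lemma le_exp_mult:
  fixes r :: real
  assumes "0 < \<delta>"
  shows "r \<le> exp (\<delta> * r) / \<delta>"
proof -
  have "\<delta> * r \<le> exp (\<delta> * r)" using exp_ge_add_one_self[of "\<delta> * r"] by linarith
  then show ?thesis using assms by (simp add: field_simps)
qed

text \<open>The second-order bound on \<open>exp\<close> replaces dominated convergence.\<close>

lemma
  fixes X :: "'b \<Rightarrow> 'a::euclidean_space" and g :: "'b \<Rightarrow> real"
  assumes [measurable]: "g \<in> borel_measurable M" "X \<in> borel_measurable M"
    and "0 < \<delta>" and int: "integrable M (\<lambda>a. g a * exp (\<delta> * norm (X a)))"
  shows integrable_of_exp_moment: "integrable M g"
    and integrable_scaleR_of_exp_moment: "integrable M (\<lambda>a. g a *\<^sub>R X a)"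
    and laplace_GDERIV: "GDERIV (\<lambda>v. \<integral>a. g a * exp (X a \<bullet> v) \<partial>M) 0 :> (\<integral>a. g a *\<^sub>R X a \<partial>M)"
proof -
  have int': "integrable M (\<lambda>a. \<bar>g a\<bar> * exp (\<delta> * norm (X a)))"
    using integrable_norm[OF int] by (simp add: abs_mult)
  show ig: "integrable M g"
  proof (rule Bochner_Integration.integrable_bound[OF int'])
    have "\<bar>g a\<bar> * 1 \<le> \<bar>g a\<bar> * exp (\<delta> * norm (X a))" for a
      using \<open>0 < \<delta>\<close> by (intro mult_left_mono) auto
    then show "AE a in M. norm (g a) \<le> norm (\<bar>g a\<bar> * exp (\<delta> * norm (X a)))" by simp
  qed simp
  show igX: "integrable M (\<lambda>a. g a *\<^sub>R X a)"
  proof (rule Bochner_Integration.integrable_bound[OF integrable_mult_right[OF int', of "1 / \<delta>"]])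
    have "\<bar>g a\<bar> * norm (X a) \<le> \<bar>g a\<bar> * (exp (\<delta> * norm (X a)) / \<delta>)" for a
      by (intro mult_left_mono le_exp_mult \<open>0 < \<delta>\<close>) auto
    then show "AE a in M. norm (g a *\<^sub>R X a) \<le> norm (1 / \<delta> * (\<bar>g a\<bar> * exp (\<delta> * norm (X a))))"
      using \<open>0 < \<delta>\<close> by (simp add: field_simps abs_mult)
  qed simp
  define J where "J = (\<integral>a. \<bar>g a\<bar> * exp (\<delta> * norm (X a)) \<partial>M)"
  define K where "K = 4 / \<delta>\<^sup>2 * J"
  define G where "G = (\<integral>a. g a *\<^sub>R X a \<partial>M)"
  define F where "F = (\<lambda>v. \<integral>a. g a * exp (X a \<bullet> v) \<partial>M)"
  \<comment> \<open>The moment exp(\<delta> |X|) is spent in two halves: one bounds exp |X . v|,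
    which is why |v| is at most \<delta> / 2; the other absorbs |X|^2 = (4 / \<delta>^2) r^2 with r
    = \<delta> |X| / 2, through r^2 <= 2 exp r. This produces the constant in
    \<open>K\<close>.\<close>
  have bound: "norm (F v - F 0 - v \<bullet> G) \<le> K * (norm v)\<^sup>2" if v: "norm v \<le> \<delta> / 2" for v
  proof -
    have Xv: "\<bar>X a \<bullet> v\<bar> \<le> \<delta> / 2 * norm (X a)" for a
    proof -
      have "\<bar>X a \<bullet> v\<bar> \<le> norm (X a) * norm v" by (rule Cauchy_Schwarz_ineq2)
      also have "\<dots> \<le> norm (X a) * (\<delta> / 2)" using v by (intro mult_left_mono) auto
      finally show ?thesis by (simp add: mult.commute)
    qed
    have iF: "integrable M (\<lambda>a. g a * exp (X a \<bullet> v))"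
    proof (rule Bochner_Integration.integrable_bound[OF int'])
      have "X a \<bullet> v \<le> \<delta> * norm (X a)" for a
        using Xv[of a] mult_nonneg_nonneg[of \<delta> "norm (X a)"] \<open>0 < \<delta>\<close> by (simp add: field_simps)
      then have "\<bar>g a\<bar> * exp (X a \<bullet> v) \<le> \<bar>g a\<bar> * exp (\<delta> * norm (X a))" for a
        by (intro mult_left_mono) auto
      then show "AE a in M. norm (g a * exp (X a \<bullet> v)) \<le> norm (\<bar>g a\<bar> * exp (\<delta> * norm (X a)))"
        by (simp add: abs_mult)
    qed simp
    have iv: "integrable M (\<lambda>a. g a * (X a \<bullet> v))"
      using integrable_inner_left[OF igX, of v] by simp
    have "F v - F 0 - v \<bullet> G = (\<integral>a. g a * exp (X a \<bullet> v) - g a - g a * (X a \<bullet> v) \<partial>M)"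
    proof -
      have "v \<bullet> G = (\<integral>a. g a * (X a \<bullet> v) \<partial>M)"
        using integral_inner_left[OF igX, of v] by (simp add: G_def inner_commute)
      then show ?thesis using iF ig iv by (simp add: F_def)
    qed
    also have "norm \<dots> \<le> (\<integral>a. 4 / \<delta>\<^sup>2 * (norm v)\<^sup>2 * (\<bar>g a\<bar> * exp (\<delta> * norm (X a))) \<partial>M)"
    proof (rule norm_integral_le_integral)
      show "integrable M (\<lambda>a. g a * exp (X a \<bullet> v) - g a - g a * (X a \<bullet> v))"
        using iF ig iv by simp
      show "integrable M (\<lambda>a. 4 / \<delta>\<^sup>2 * (norm v)\<^sup>2 * (\<bar>g a\<bar> * exp (\<delta> * norm (X a))))"
        using int' by simp
      fix a
      let ?r = "\<delta> / 2 * norm (X a)"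
      have "0 \<le> ?r" using \<open>0 < \<delta>\<close> by simp
      have "\<bar>exp (X a \<bullet> v) - 1 - X a \<bullet> v\<bar> \<le> (X a \<bullet> v)\<^sup>2 * exp \<bar>X a \<bullet> v\<bar> / 2"
        by (rule exp_sub_one_sub_abs_le)
      also have "\<dots> \<le> (norm (X a) * norm v)\<^sup>2 * exp ?r / 2"
      proof -
        have "(X a \<bullet> v)\<^sup>2 \<le> (norm (X a) * norm v)\<^sup>2"
          using Cauchy_Schwarz_ineq2[of "X a" v] by (simp add: abs_le_square_iff[symmetric])
        moreover have "exp \<bar>X a \<bullet> v\<bar> \<le> exp ?r" using Xv by simp
        ultimately have "(X a \<bullet> v)\<^sup>2 * exp \<bar>X a \<bullet> v\<bar> \<le> (norm (X a) * norm v)\<^sup>2 * exp ?r"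
          by (intro mult_mono) auto
        then show ?thesis by simp
      qed
      also have "\<dots> = (2 / \<delta>\<^sup>2 * (norm v)\<^sup>2 * exp ?r) * ?r\<^sup>2"
        using \<open>0 < \<delta>\<close> by (simp add: field_simps power2_eq_square)
      also have "\<dots> \<le> (2 / \<delta>\<^sup>2 * (norm v)\<^sup>2 * exp ?r) * (2 * exp ?r)"
        by (intro mult_left_mono power2_le_exp \<open>0 \<le> ?r\<close>) auto
      also have "\<dots> = 4 / \<delta>\<^sup>2 * (norm v)\<^sup>2 * exp (\<delta> * norm (X a))"
        by (simp add: exp_add[symmetric])
      finally have *: "\<bar>g a\<bar> * \<bar>exp (X a \<bullet> v) - 1 - X a \<bullet> v\<bar>
          \<le> \<bar>g a\<bar> * (4 / \<delta>\<^sup>2 * (norm v)\<^sup>2 * exp (\<delta> * norm (X a)))"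
        by (intro mult_left_mono) auto
      show "norm (g a * exp (X a \<bullet> v) - g a - g a * (X a \<bullet> v))
          \<le> 4 / \<delta>\<^sup>2 * (norm v)\<^sup>2 * (\<bar>g a\<bar> * exp (\<delta> * norm (X a)))"
      proof -
        have "norm (g a * exp (X a \<bullet> v) - g a - g a * (X a \<bullet> v))
            = \<bar>g a\<bar> * \<bar>exp (X a \<bullet> v) - 1 - X a \<bullet> v\<bar>"
          unfolding abs_mult[symmetric] real_norm_def by (simp only: right_diff_distrib mult_1_right)
        then show ?thesis using * by (simp only: mult.assoc mult.left_commute)
      qed
    qed
    also have "\<dots> = K * (norm v)\<^sup>2" by (simp add: K_def J_def)
    finally show ?thesis .
  qed
  have "(F has_derivative (\<lambda>h. h \<bullet> G)) (at 0)"
    unfolding has_derivative_at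
  proof (intro conjI bounded_linear_inner_left)
    show "(\<lambda>h. norm (F (0 + h) - F 0 - h \<bullet> G) / norm h) \<midarrow>0\<rightarrow> 0"
    proof (rule Lim_null_comparison)
      show "((\<lambda>h. K * norm h) \<longlongrightarrow> 0) (at 0)"
        by (auto intro!: tendsto_eq_intros)
      have "\<forall>\<^sub>F h in at 0. norm (h::'a) < \<delta> / 2"
        using \<open>0 < \<delta>\<close> by (auto simp: eventually_at dist_norm intro!: exI[of _ "\<delta> / 2"])
      then show "\<forall>\<^sub>F h in at 0. norm (norm (F (0 + h) - F 0 - h \<bullet> G) / norm h) \<le> K * norm h"
      proof eventually_elim
        case (elim h)
        with bound[of h] show ?case
          by (cases "h = 0") (simp_all add: field_simps power2_eq_square)
      qed
    qed
  qed
  then show "GDERIV (\<lambda>v. \<integral>a. g a * exp (X a \<bullet> v) \<partial>M) 0 :> (\<integral>a. g a *\<^sub>R X a \<partial>M)"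
    unfolding gderiv_def F_def G_def .
qed

section \<open>Uniqueness of gradients and first-order expansion of exponentially tilted
  means\<close>

lemma grad_eqI:
  assumes D: "GDERIV g y :> D"
  shows "grad g y = D"
  unfolding grad_def
proof (rule the_equality)
  show "GDERIV g y :> D" by (rule D)
  show "D' = D" if "GDERIV g y :> D'" for D'
  proof -
    have "(\<lambda>h. h \<bullet> D') = (\<lambda>h. h \<bullet> D)"
      using that D unfolding gderiv_def by (rule has_derivative_unique)
    then have "h \<bullet> D' = h \<bullet> D" for h by (rule fun_cong)
    then show ?thesis using vector_eq_ldot[of D' D] by (simp add: inner_commute)
  qed
qed

text \<open>With mean-zero \<open>U\<close> and \<open>V\<close> the tilted mean is \<open>(\<epsilon> E[U V] + O(\<epsilon>\<^sup>2)) / (1 + O(\<epsilon>\<^sup>2))\<close>.\<close>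

lemma (in prob_space) centered_tilt_expansion:
  fixes V :: "'a \<Rightarrow> 'b::euclidean_space" and U :: "'a \<Rightarrow> real"
  assumes [measurable]: "U \<in> borel_measurable M" and V: "integrable M V"
    and U: "\<And>a. \<bar>U a\<bar> \<le> C" and "expectation U = 0" "(\<integral>a. V a \<partial>M) = 0"
  shows "\<exists>K. \<forall>\<epsilon>. 0 < \<epsilon> \<and> \<epsilon> \<le> 1 \<longrightarrow>
    norm ((1 / (\<integral>a. exp (\<epsilon> * U a) \<partial>M)) *\<^sub>R (\<integral>a. exp (\<epsilon> * U a) *\<^sub>R V a \<partial>M)
           - \<epsilon> *\<^sub>R (\<integral>a. U a *\<^sub>R V a \<partial>M)) \<le> K * \<epsilon>\<^sup>2"
proof -
  note [measurable] = borel_measurable_integrable[OF V]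
  have "0 \<le> C" using U[of undefined] by linarith
  define B where "B = C\<^sup>2 * exp C / 2"
  define c where "c = (\<integral>a. U a *\<^sub>R V a \<partial>M)"
  define m where "m = (\<integral>a. norm (V a) \<partial>M)"
  have "0 \<le> B" by (simp add: B_def)
  have "0 \<le> m" by (simp add: m_def)
  have iU: "integrable M U"
    by (rule integrable_const_bound[where B=C]) (use U in auto)
  have bV: "integrable M (\<lambda>a. h a *\<^sub>R V a)"
    if [measurable]: "h \<in> borel_measurable M" and "\<And>a. \<bar>h a\<bar> \<le> D" for h :: "'a \<Rightarrow> real" and D
  proof (rule Bochner_Integration.integrable_bound[of _ "\<lambda>a. D * norm (V a)"])
    show "integrable M (\<lambda>a. D * norm (V a))" using V by simp
    have "\<bar>h a\<bar> * norm (V a) \<le> D * norm (V a)" for a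
      by (intro mult_right_mono that) auto
    then show "AE a in M. norm (h a *\<^sub>R V a) \<le> norm (D * norm (V a))"
      by (auto intro: order_trans[OF _ abs_ge_self])
  qed simp
  have "norm ((1 / (\<integral>a. exp (\<epsilon> * U a) \<partial>M)) *\<^sub>R (\<integral>a. exp (\<epsilon> * U a) *\<^sub>R V a \<partial>M) - \<epsilon> *\<^sub>R c)
      \<le> exp C * (B * m + B * norm c) * \<epsilon>\<^sup>2" if \<epsilon>: "0 < \<epsilon>" "\<epsilon> \<le> 1" for \<epsilon>
  proof -
    have \<epsilon>U: "\<bar>\<epsilon> * U a\<bar> \<le> C" for a
      using mult_mono[of \<epsilon> 1 "\<bar>U a\<bar>" C] \<epsilon> U[of a] by (simp add: abs_mult)
    define R where "R = (\<lambda>a. exp (\<epsilon> * U a) - 1 - \<epsilon> * U a)"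
    have R: "\<bar>R a\<bar> \<le> \<epsilon>\<^sup>2 * B" for a
    proof -
      have "\<bar>R a\<bar> \<le> (\<epsilon> * U a)\<^sup>2 * exp \<bar>\<epsilon> * U a\<bar> / 2"
        unfolding R_def by (rule exp_sub_one_sub_abs_le)
      also have "(\<epsilon> * U a)\<^sup>2 * exp \<bar>\<epsilon> * U a\<bar> \<le> (\<epsilon> * C)\<^sup>2 * exp C"
      proof (intro mult_mono)
        show "(\<epsilon> * U a)\<^sup>2 \<le> (\<epsilon> * C)\<^sup>2"
          using U[of a] \<epsilon> \<open>0 \<le> C\<close> by (simp add: abs_le_square_iff[symmetric] abs_mult)
      qed (use \<epsilon>U[of a] in auto)
      finally show ?thesis by (simp add: B_def power_mult_distrib)
    qed
    have [measurable]: "R \<in> borel_measurable M" by (simp add: R_def)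
    have iR: "integrable M R"
      by (rule integrable_const_bound[where B="\<epsilon>\<^sup>2 * B"]) (use R in auto)
    have e: "exp (\<epsilon> * U a) = 1 + \<epsilon> * U a + R a" for a by (simp add: R_def)
    define D where "D = (\<integral>a. exp (\<epsilon> * U a) \<partial>M)"
    have iE: "integrable M (\<lambda>a. exp (\<epsilon> * U a))" unfolding e using iU iR by simp
    have D1: "D = 1 + expectation R"
      unfolding D_def e using iU iR assms(4) by (simp add: prob_space)
    \<comment> \<open>A lower bound for the normaliser that is uniform in \<epsilon> <= 1, so that
      dividing by \<open>D\<close> costs at most a factor exp C.\<close>
    have "exp (- C) \<le> exp (\<epsilon> * U a)" for a using \<epsilon>U[of a] by simp
    then have "(\<integral>a. exp (- C) \<partial>M) \<le> D"
      unfolding D_def by (intro integral_mono iE) auto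
    then have Dge: "exp (- C) \<le> D" by (simp add: prob_space)
    then have "0 < D" using exp_gt_zero[of "- C"] by linarith
    have nR: "\<bar>expectation R\<bar> \<le> \<epsilon>\<^sup>2 * B"
    proof -
      have "norm (expectation R) \<le> (\<integral>a. \<epsilon>\<^sup>2 * B \<partial>M)"
        by (rule norm_integral_le_integral) (use iR R in auto)
      then show ?thesis by (simp add: prob_space)
    qed
    have iUV: "integrable M (\<lambda>a. U a *\<^sub>R V a)" and iRV: "integrable M (\<lambda>a. R a *\<^sub>R V a)"
      using bV[of U C] bV[of R "\<epsilon>\<^sup>2 * B"] U R by auto
    define N where "N = (\<integral>a. exp (\<epsilon> * U a) *\<^sub>R V a \<partial>M)"
    have N: "N = \<epsilon> *\<^sub>R c + (\<integral>a. R a *\<^sub>R V a \<partial>M)"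
    proof -
      have "N = (\<integral>a. V a + (\<epsilon> *\<^sub>R (U a *\<^sub>R V a) + R a *\<^sub>R V a) \<partial>M)"
        unfolding N_def e by (simp add: algebra_simps)
      then show ?thesis using V iUV iRV assms(5) by (simp add: c_def del: scaleR_scaleR)
    qed
    have "norm (\<integral>a. R a *\<^sub>R V a \<partial>M) \<le> (\<integral>a. (\<epsilon>\<^sup>2 * B) * norm (V a) \<partial>M)"
    proof (rule norm_integral_le_integral[OF iRV])
      fix a
      show "norm (R a *\<^sub>R V a) \<le> \<epsilon>\<^sup>2 * B * norm (V a)"
        using mult_right_mono[OF R norm_ge_zero[of "V a"], of a] by simp
    qed (use V in simp)
    then have nRV: "norm (\<integral>a. R a *\<^sub>R V a \<partial>M) \<le> \<epsilon>\<^sup>2 * B * m" by (simp add: m_def)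
    \<comment> \<open>Putting \<epsilon> c over the common denominator \<open>D\<close> cancels the
      main term: since D - 1 is the expectation of \<open>R\<close>, only the two remainders
      survive. The second is of order \<epsilon>^3 and is weakened to \<epsilon>^2.\<close>
    have "(1 / D) *\<^sub>R N - \<epsilon> *\<^sub>R c = (1 / D) *\<^sub>R ((\<integral>a. R a *\<^sub>R V a \<partial>M) - (\<epsilon> * expectation R) *\<^sub>R c)"
    proof -
      have "\<epsilon> *\<^sub>R c = (1 / D) *\<^sub>R (D * \<epsilon>) *\<^sub>R c" using \<open>0 < D\<close> by simp
      then have "(1 / D) *\<^sub>R N - \<epsilon> *\<^sub>R c = (1 / D) *\<^sub>R (N - (D * \<epsilon>) *\<^sub>R c)"
        by (simp only: scaleR_right_diff_distrib)
      moreover have "N - (D * \<epsilon>) *\<^sub>R c = (\<integral>a. R a *\<^sub>R V a \<partial>M) - (\<epsilon> * expectation R) *\<^sub>R c"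
        unfolding N D1 by (simp add: scaleR_left_distrib ring_distribs mult.commute)
      ultimately show ?thesis by (simp only:)
    qed
    also have "norm \<dots> \<le> exp C * (\<epsilon>\<^sup>2 * B * m + \<epsilon>\<^sup>2 * B * norm c)"
    proof -
      have "norm ((\<integral>a. R a *\<^sub>R V a \<partial>M) - (\<epsilon> * expectation R) *\<^sub>R c)
          \<le> \<epsilon>\<^sup>2 * B * m + \<epsilon>\<^sup>2 * B * norm c"
      proof (rule order_trans[OF norm_triangle_ineq4 add_mono[OF nRV]])
        have "\<epsilon> * \<bar>expectation R\<bar> \<le> 1 * (\<epsilon>\<^sup>2 * B)" using \<epsilon> nR by (intro mult_mono) auto
        then have "\<epsilon> * \<bar>expectation R\<bar> * norm c \<le> (\<epsilon>\<^sup>2 * B) * norm c"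
          by (intro mult_right_mono) auto
        then show "norm ((\<epsilon> * expectation R) *\<^sub>R c) \<le> \<epsilon>\<^sup>2 * B * norm c"
          using \<epsilon> by (simp add: abs_mult)
      qed
      moreover have "1 / D \<le> exp C"
        using Dge \<open>0 < D\<close> by (simp add: exp_minus field_simps)
      ultimately show ?thesis
        using \<open>0 < D\<close> unfolding norm_scaleR by (intro mult_mono) auto
    qed
    also have "\<dots> = exp C * (B * m + B * norm c) * \<epsilon>\<^sup>2" by (simp add: algebra_simps)
    finally show ?thesis unfolding D_def N_def .
  qed
  then show ?thesis unfolding c_def by blast
qed

text \<open>Reduction to the centred case: replacing A by A - e multiplies numerator and normaliser
  by the same factor exp(-\<epsilon> e), and replacing X by X - x subtracts x from the tilted
  mean.\<close>

lemma (in prob_space) tilt_expansion: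
  fixes X :: "'a \<Rightarrow> 'b::euclidean_space" and A :: "'a \<Rightarrow> real"
  assumes [measurable]: "A \<in> borel_measurable M" and X: "integrable M X"
    and A: "\<And>a. \<bar>A a\<bar> \<le> C"
  shows "\<exists>K. \<forall>\<epsilon>. 0 < \<epsilon> \<and> \<epsilon> \<le> 1 \<longrightarrow>
    norm ((1 / (\<integral>a. exp (\<epsilon> * A a) \<partial>M)) *\<^sub>R (\<integral>a. exp (\<epsilon> * A a) *\<^sub>R X a \<partial>M) - (\<integral>a. X a \<partial>M)
           - \<epsilon> *\<^sub>R (\<integral>a. (A a - expectation A) *\<^sub>R (X a - (\<integral>a. X a \<partial>M)) \<partial>M)) \<le> K * \<epsilon>\<^sup>2"
proof -
  note [measurable] = borel_measurable_integrable[OF X]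
  define e where "e = expectation A"
  define x where "x = (\<integral>a. X a \<partial>M)"
  have iA: "integrable M A"
    by (rule integrable_const_bound[where B=C]) (use A in auto)
  have "\<exists>K. \<forall>\<epsilon>. 0 < \<epsilon> \<and> \<epsilon> \<le> 1 \<longrightarrow>
    norm ((1 / (\<integral>a. exp (\<epsilon> * (A a - e)) \<partial>M)) *\<^sub>R (\<integral>a. exp (\<epsilon> * (A a - e)) *\<^sub>R (X a - x) \<partial>M)
           - \<epsilon> *\<^sub>R (\<integral>a. (A a - e) *\<^sub>R (X a - x) \<partial>M)) \<le> K * \<epsilon>\<^sup>2"
  proof (rule centered_tilt_expansion[where C="C + \<bar>e\<bar>"])
    show "\<bar>A a - e\<bar> \<le> C + \<bar>e\<bar>" for a using A[of a] by linarith
  qed (use iA X in \<open>auto simp: e_def x_def prob_space\<close>)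
  moreover have "(1 / (\<integral>a. exp (\<epsilon> * (A a - e)) \<partial>M)) *\<^sub>R (\<integral>a. exp (\<epsilon> * (A a - e)) *\<^sub>R (X a - x) \<partial>M)
      = (1 / (\<integral>a. exp (\<epsilon> * A a) \<partial>M)) *\<^sub>R (\<integral>a. exp (\<epsilon> * A a) *\<^sub>R X a \<partial>M) - x"
    if "0 < \<epsilon>" "\<epsilon> \<le> 1" for \<epsilon>
  proof -
    have \<epsilon>A: "\<bar>\<epsilon> * A a\<bar> \<le> C" for a
      using mult_mono[of \<epsilon> 1 "\<bar>A a\<bar>" C] that A[of a] by (simp add: abs_mult)
    have iE: "integrable M (\<lambda>a. exp (\<epsilon> * A a))"
      by (rule integrable_const_bound[where B="exp C"]) (use \<epsilon>A in \<open>auto simp: abs_le_iff\<close>)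
    have iEX: "integrable M (\<lambda>a. exp (\<epsilon> * A a) *\<^sub>R X a)"
    proof (rule Bochner_Integration.integrable_bound[of _ "\<lambda>a. exp C * norm (X a)"])
      show "integrable M (\<lambda>a. exp C * norm (X a))" using X by simp
      have "exp (\<epsilon> * A a) * norm (X a) \<le> exp C * norm (X a)" for a
        using \<epsilon>A[of a] by (intro mult_right_mono) auto
      then show "AE a in M. norm (exp (\<epsilon> * A a) *\<^sub>R X a) \<le> norm (exp C * norm (X a))"
        by simp
    qed simp
    define D where "D = (\<integral>a. exp (\<epsilon> * A a) \<partial>M)"
    have "exp (- C) \<le> exp (\<epsilon> * A a)" for a using \<epsilon>A[of a] by simp
    then have "(\<integral>a. exp (- C) \<partial>M) \<le> D"
      unfolding D_def by (intro integral_mono iE) auto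
    then have "exp (- C) \<le> D" by (simp add: prob_space)
    then have "D > 0" using exp_gt_zero[of "- C"] by linarith
    have ex: "exp (\<epsilon> * (A a - e)) = exp (- \<epsilon> * e) * exp (\<epsilon> * A a)" for a
      by (simp add: exp_add[symmetric] algebra_simps)
    have 1: "(\<integral>a. exp (\<epsilon> * (A a - e)) \<partial>M) = exp (- \<epsilon> * e) * D"
      unfolding ex D_def by simp
    have 2: "(\<integral>a. exp (\<epsilon> * (A a - e)) *\<^sub>R (X a - x) \<partial>M)
        = exp (- \<epsilon> * e) *\<^sub>R ((\<integral>a. exp (\<epsilon> * A a) *\<^sub>R X a \<partial>M) - D *\<^sub>R x)"
    proof -
      have "(\<integral>a. exp (\<epsilon> * (A a - e)) *\<^sub>R (X a - x) \<partial>M)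
          = (\<integral>a. exp (- \<epsilon> * e) *\<^sub>R (exp (\<epsilon> * A a) *\<^sub>R X a - exp (\<epsilon> * A a) *\<^sub>R x) \<partial>M)"
        unfolding ex by (simp add: scaleR_right_diff_distrib)
      also have "\<dots> = exp (- \<epsilon> * e) *\<^sub>R (\<integral>a. exp (\<epsilon> * A a) *\<^sub>R X a - exp (\<epsilon> * A a) *\<^sub>R x \<partial>M)"
        by simp
      also have "(\<integral>a. exp (\<epsilon> * A a) *\<^sub>R X a - exp (\<epsilon> * A a) *\<^sub>R x \<partial>M)
          = (\<integral>a. exp (\<epsilon> * A a) *\<^sub>R X a \<partial>M) - D *\<^sub>R x"
        using iE iEX by (simp add: D_def)
      finally show ?thesis .
    qed
    show ?thesis unfolding 1 2 D_def[symmetric]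
      using \<open>D > 0\<close> by (simp add: scaleR_right_diff_distrib)
  qed
  ultimately show ?thesis unfolding e_def x_def by simp
qed

section \<open>Gaussian densities and the bridge kernel\<close>

lemma gauss_density_eq:
  fixes x :: "'a::euclidean_space"
  assumes "0 < u"
  shows "gauss_density u x = (1 / sqrt (2 * pi * u)) ^ DIM('a) * exp (- (norm x)\<^sup>2 / (2 * u))"
proof -
  have "gauss_density u x = (\<Prod>b\<in>Basis. 1 / sqrt (2 * pi * u) * exp (- (x \<bullet> b)\<^sup>2 / (2 * u)))"
    using assms by (simp add: gauss_density_def normal_density_def)
  also have "\<dots> = (1 / sqrt (2 * pi * u)) ^ DIM('a) * exp (\<Sum>b\<in>Basis. - (x \<bullet> b)\<^sup>2 / (2 * u))"
    by (simp add: prod.distrib prod_constant exp_sum power_divide prod_dividef)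
  also have "(\<Sum>b\<in>Basis. - (x \<bullet> b)\<^sup>2 / (2 * u)) = - (norm x)\<^sup>2 / (2 * u)"
    unfolding power2_norm_eq_inner euclidean_inner[of x x]
    by (simp add: sum_divide_distrib sum_negf power2_eq_square)
  finally show ?thesis .
qed

lemma gauss_density_pos: "0 < u \<Longrightarrow> 0 < gauss_density u x"
  by (simp add: gauss_density_eq)

lemma measurable_gauss_density [measurable]: "gauss_density u \<in> borel_measurable borel"
  unfolding gauss_density_def by measurable

lemma gauss_density_scaleR:
  fixes z :: "'a::euclidean_space"
  assumes "0 < u"
  shows "sqrt u ^ DIM('a) * gauss_density u (sqrt u *\<^sub>R z) = gauss_density 1 z"
proof -
  have "(sqrt u * (1 / sqrt (2 * pi * u))) ^ DIM('a) = (1 / sqrt (2 * pi)) ^ DIM('a)"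
    using assms by (simp add: real_sqrt_mult)
  then show ?thesis
    using assms unfolding power_mult_distrib by (simp add: gauss_density_eq mult.assoc[symmetric] power_mult_distrib)
qed

lemma sets_std_gaussian [simp, measurable_cong]: "sets std_gaussian = sets borel"
  by (simp add: std_gaussian_def)

lemma space_std_gaussian [simp]: "space std_gaussian = UNIV"
  by (simp add: std_gaussian_def)

lemma sigma_finite_std_gaussian: "sigma_finite_measure (std_gaussian :: 'a::euclidean_space measure)"
  unfolding std_gaussian_def
  by (subst sigma_finite_measure.sigma_finite_iff_density_finite[OF sigma_finite_lborel]) auto

text \<open>Up to the factor \<open>gauss_density (1 - u) x\<close>, which does not depend on \<open>a\<close>, this is the
  density at \<open>x\<close> of the position at time \<open>1 - u\<close> of a Brownian bridge from 0 to \<open>a\<close>.\<close>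

definition bridge_density :: "real \<Rightarrow> 'a::euclidean_space \<Rightarrow> 'a \<Rightarrow> real" where
  "bridge_density u x a = gauss_density u (a - x) / gauss_density 1 a"

lemma bridge_density_pos: "0 < u \<Longrightarrow> 0 < bridge_density u x a"
  by (simp add: bridge_density_def gauss_density_pos)

lemma measurable_bridge_density [measurable (raw)]:
  assumes [measurable]: "f \<in> borel_measurable M" "g \<in> borel_measurable M"
  shows "(\<lambda>w. bridge_density u (f w) (g w)) \<in> borel_measurable M"
  unfolding bridge_density_def by measurable

text \<open>Expands |a - x|^2 around y. The dependence on x and a together sits in one linear
  exponent, so integrals of the kernel become Laplace transforms in x - y.\<close>

lemma bridge_density_shift:
  assumes "0 < u"
  shows "bridge_density u x a
    = bridge_density u y a * exp (((1 / u) *\<^sub>R (a - y)) \<bullet> (x - y)) * exp (- (norm (x - y))\<^sup>2 / (2 * u))"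
proof -
  have e: "(norm (a - x))\<^sup>2 = (norm (a - y))\<^sup>2 - 2 * ((a - y) \<bullet> (x - y)) + (norm (x - y))\<^sup>2"
    by (simp add: power2_norm_eq_inner inner_diff_left inner_diff_right inner_commute)
  have "- (norm (a - x))\<^sup>2 / (2 * u) = - (norm (a - y))\<^sup>2 / (2 * u)
      + ((1 / u) *\<^sub>R (a - y)) \<bullet> (x - y) + (- (norm (x - y))\<^sup>2 / (2 * u))"
    unfolding inner_scaleR_left e by (simp add: diff_divide_distrib add_divide_distrib)
  then show ?thesis
    unfolding bridge_density_def gauss_density_eq[OF assms] by (simp only: exp_add) simp
qed

text \<open>The image is N(x, u I), and its density relative to the standard Gaussian is the bridge
  kernel. This is the link between the heat semigroup and the Brownian bridge.\<close>

lemma distr_std_gaussian_affine: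
  fixes x :: "'a::euclidean_space"
  assumes "0 < u"
  shows "distr std_gaussian borel (\<lambda>z. x + sqrt u *\<^sub>R z)
    = density std_gaussian (\<lambda>a. ennreal (bridge_density u x a))"
proof -
  define T where "T = (\<lambda>z::'a. x + sqrt u *\<^sub>R z)"
  have [measurable]: "T \<in> borel_measurable borel" by (simp add: T_def)
  have "density std_gaussian (\<lambda>a. ennreal (bridge_density u x a))
      = density lborel (\<lambda>a. ennreal (gauss_density u (a - x)))"
  proof -
    have "gauss_density 1 a * bridge_density u x a = gauss_density u (a - x)" for a :: 'a
      using gauss_density_pos[of 1 a] by (simp add: bridge_density_def)
    then show ?thesis
      unfolding std_gaussian_def
      by (subst density_density_eq)
         (auto simp: ennreal_mult[symmetric] less_imp_le gauss_density_pos bridge_density_pos assms)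
  qed
  \<comment> \<open>Lebesgue measure is written as its own image under \<open>T\<close>, with
    Jacobian \<open>sqrt u ^ DIM('a)\<close>. Pulling the density back through \<open>T\<close> then
    leaves exactly the standard Gaussian density.\<close>
  also have "\<dots> = density (density (distr lborel borel T) (\<lambda>_. ennreal (sqrt u ^ DIM('a))))
      (\<lambda>a. ennreal (gauss_density u (a - x)))"
    using lborel_affine[of "sqrt u" x] assms by (simp add: T_def)
  also have "\<dots> = density (distr lborel borel T)
      (\<lambda>a. ennreal (sqrt u ^ DIM('a)) * ennreal (gauss_density u (a - x)))"
    by (subst density_density_eq) auto
  also have "\<dots> = distr (density lborel
      (\<lambda>z. ennreal (sqrt u ^ DIM('a)) * ennreal (gauss_density u (T z - x)))) borel T"
    by (subst density_distr) auto
  also have "(\<lambda>z. ennreal (sqrt u ^ DIM('a)) * ennreal (gauss_density u (T z - x)))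
      = (\<lambda>z. ennreal (gauss_density 1 z))"
    using assms gauss_density_scaleR[OF assms, where 'a='a] gauss_density_pos[OF assms, where 'a='a]
    by (auto simp: T_def ennreal_mult[symmetric] less_imp_le)
  finally show ?thesis by (simp add: std_gaussian_def T_def)
qed

section \<open>Density ratios and the heat semigroup as an integral against the policy\<close>

lemma measurable_density_ratio [measurable]: "density_ratio \<mu> \<in> borel_measurable borel"
  unfolding density_ratio_def[abs_def]
  using borel_measurable_RN_deriv[of std_gaussian \<mu>] by measurable

lemma density_ratio_nonneg: "0 \<le> density_ratio \<mu> x"
  by (simp add: density_ratio_def)

text \<open>\<open>enn2real\<close> sends infinity to 0, so recovering \<open>\<mu>\<close> requires
  the Radon-Nikodym derivative to be finite almost everywhere; sigma-finiteness of
  \<open>\<mu>\<close> gives this.\<close>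

lemma density_density_ratio:
  fixes \<mu> :: "'a::euclidean_space measure"
  assumes "finite_measure \<mu>" and [simp]: "sets \<mu> = sets borel"
    and ac: "absolutely_continuous std_gaussian \<mu>"
  shows "density std_gaussian (\<lambda>x. ennreal (density_ratio \<mu> x)) = \<mu>"
proof -
  interpret G: sigma_finite_measure "std_gaussian :: 'a measure" by (rule sigma_finite_std_gaussian)
  interpret finite_measure \<mu> by fact
  have "AE x in std_gaussian. RN_deriv std_gaussian \<mu> x \<noteq> \<infinity>"
    by (rule G.RN_deriv_finite[OF _ ac]) (auto intro: sigma_finite_measure_axioms)
  then have "density std_gaussian (\<lambda>x. ennreal (density_ratio \<mu> x))
      = density std_gaussian (RN_deriv std_gaussian \<mu>)"
    by (intro density_cong) (auto simp: density_ratio_def less_top)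
  also have "\<dots> = \<mu>" by (rule G.density_RN_deriv[OF ac]) simp
  finally show ?thesis .
qed

text \<open>Change of variables to N(x, u I), then the density ratio is absorbed into
  \<open>\<mu>\<close>. The integrability equivalence translates the condition on the heat integral
  at time 0 into a moment condition on \<open>\<mu>\<close>.\<close>

lemma
  fixes \<mu> :: "'a::euclidean_space measure"
  assumes \<mu>: "finite_measure \<mu>" "sets \<mu> = sets borel" "absolutely_continuous std_gaussian \<mu>"
    and "0 < u"
  shows heat_density_ratio: "heat u (density_ratio \<mu>) x = (\<integral>a. bridge_density u x a \<partial>\<mu>)"
    and integrable_heat_density_ratio_iff:
      "integrable std_gaussian (\<lambda>z. density_ratio \<mu> (x + sqrt u *\<^sub>R z))
        \<longleftrightarrow> integrable \<mu> (bridge_density u x)"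
proof -
  let ?f = "density_ratio \<mu>" and ?G = "std_gaussian :: 'a measure"
  note pos = less_imp_le[OF bridge_density_pos[OF \<open>0 < u\<close>]]
  have "heat u ?f x = (\<integral>a. ?f a \<partial>distr ?G borel (\<lambda>z. x + sqrt u *\<^sub>R z))"
    unfolding heat_def by (subst integral_distr) auto
  also have "\<dots> = (\<integral>a. bridge_density u x a * ?f a \<partial>?G)"
    unfolding distr_std_gaussian_affine[OF \<open>0 < u\<close>] by (subst integral_density) (auto simp: pos)
  also have "\<dots> = (\<integral>a. bridge_density u x a \<partial>density ?G (\<lambda>x. ennreal (?f x)))"
    by (subst integral_density) (auto simp: density_ratio_nonneg mult.commute)
  finally show "heat u ?f x = (\<integral>a. bridge_density u x a \<partial>\<mu>)"
    unfolding density_density_ratio[OF \<mu>] .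
  have "integrable ?G (\<lambda>z. ?f (x + sqrt u *\<^sub>R z))
      \<longleftrightarrow> integrable (distr ?G borel (\<lambda>z. x + sqrt u *\<^sub>R z)) ?f"
    by (subst integrable_distr_eq) auto
  also have "\<dots> \<longleftrightarrow> integrable ?G (\<lambda>a. bridge_density u x a * ?f a)"
    unfolding distr_std_gaussian_affine[OF \<open>0 < u\<close>] by (subst integrable_density) (auto simp: pos)
  also have "\<dots> \<longleftrightarrow> integrable (density ?G (\<lambda>x. ennreal (?f x))) (bridge_density u x)"
    by (subst integrable_density) (auto simp: density_ratio_nonneg mult.commute)
  finally show "integrable ?G (\<lambda>z. ?f (x + sqrt u *\<^sub>R z)) \<longleftrightarrow> integrable \<mu> (bridge_density u x)"
    unfolding density_density_ratio[OF \<mu>] .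
qed

section \<open>Exponential moments of the bridge kernel and differentiation under the
  integral\<close>

text \<open>Automatic for \<open>u < 1\<close>, where the kernel has Gaussian decay in \<open>a\<close>; for \<open>u = 1\<close> and
  \<open>y = 0\<close> it says that \<open>\<mu>\<close> has an exponential moment.\<close>

definition bridge_exp_integrable :: "'a::euclidean_space measure \<Rightarrow> real \<Rightarrow> 'a \<Rightarrow> bool" where
  "bridge_exp_integrable \<mu> u y \<longleftrightarrow> (\<exists>\<delta>>0.
     integrable \<mu> (\<lambda>a. bridge_density u y a * exp (\<delta> * norm ((1 / u) *\<^sub>R (a - y)))))"

text \<open>With \<delta> = 1 the integrand is bounded in a: its exponent is at most a quadratic in
  r = |a - y| with negative leading coefficient. Bounded functions are integrable under a
  probability measure.\<close>

lemma bridge_exp_integrable_interior: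
  fixes y :: "'a::euclidean_space"
  assumes "prob_space \<mu>" and [measurable_cong]: "sets \<mu> = sets borel" and u: "0 < u" "u < 1"
  shows "bridge_exp_integrable \<mu> u y"
proof -
  interpret prob_space \<mu> by fact
  \<comment> \<open>After |a| <= r + |y| the exponent is at most -c r^2 + \<beta> r + |y|^2 / 2. In
    \<open>\<beta>\<close>, |y| is the cross term and 1/u comes from the exponential moment.
    \<open>c\<close> is positive because u < 1, and \<open>B\<close> is the bound from completing
    the square.\<close>
  define c where "c = (1 / u - 1) / 2"
  define \<beta> where "\<beta> = norm y + 1 / u"
  have "0 < c" using u by (simp add: c_def)
  define B where "B = \<beta>\<^sup>2 / (4 * c) + (norm y)\<^sup>2 / 2"
  define k where "k = (1 / sqrt (2 * pi * u)) ^ DIM('a) / (1 / sqrt (2 * pi)) ^ DIM('a)"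
  have "0 \<le> k" using u by (simp add: k_def)
  have e: "bridge_density u y a * exp (1 * norm ((1 / u) *\<^sub>R (a - y))) \<le> k * exp B" for a
  proof -
    define r where "r = norm (a - y)"
    have "norm a \<le> r + norm y" using norm_triangle_sub[of a y] by (simp add: r_def)
    then have "(norm a)\<^sup>2 \<le> (r + norm y)\<^sup>2" by (rule power_mono) simp
    then have "- r\<^sup>2 / (2 * u) + (norm a)\<^sup>2 / 2 + r / u
        \<le> - r\<^sup>2 / (2 * u) + (r + norm y)\<^sup>2 / 2 + r / u" by simp
    also have "\<dots> = - c * r\<^sup>2 + \<beta> * r + (norm y)\<^sup>2 / 2"
      using u by (simp add: c_def \<beta>_def field_simps power2_eq_square)
    also have "\<dots> \<le> B"
    proof -
      have "0 \<le> c * (r - \<beta> / (2 * c))\<^sup>2" using \<open>0 < c\<close> by simp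
      also have "\<dots> = c * r\<^sup>2 - \<beta> * r + \<beta>\<^sup>2 / (4 * c)"
        using \<open>0 < c\<close> by (simp add: field_simps power2_eq_square)
      finally show ?thesis by (simp add: B_def)
    qed
    finally have "exp (- r\<^sup>2 / (2 * u) + (norm a)\<^sup>2 / 2 + r / u) \<le> exp B" by simp
    then have "k * exp (- r\<^sup>2 / (2 * u) + (norm a)\<^sup>2 / 2 + r / u) \<le> k * exp B"
      using \<open>0 \<le> k\<close> by (rule mult_left_mono)
    moreover have "bridge_density u y a = k * exp (- r\<^sup>2 / (2 * u) + (norm a)\<^sup>2 / 2)"
    proof -
      have "exp (- r\<^sup>2 / (2 * u) + (norm a)\<^sup>2 / 2) = exp (- r\<^sup>2 / (2 * u)) / exp (- (norm a)\<^sup>2 / 2)"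
        by (simp flip: exp_diff)
      then show ?thesis
        using u by (simp add: bridge_density_def gauss_density_eq k_def r_def)
    qed
    ultimately show ?thesis using u by (simp add: exp_add r_def mult.assoc)
  qed
  have "integrable \<mu> (\<lambda>a. bridge_density u y a * exp (1 * norm ((1 / u) *\<^sub>R (a - y))))"
    by (rule integrable_const_bound[where B="k * exp B"])
       (use e bridge_density_pos[OF u(1), of y] in
         \<open>auto simp: abs_mult less_imp_le simp del: norm_scaleR intro!: AE_I2\<close>)
  then show ?thesis unfolding bridge_exp_integrable_def using zero_less_one by blast
qed

text \<open>The coordinate of largest modulus is at least norm a / DIM, and exp |x| <= exp x +
  exp(-x). An exponential moment of the norm thus reduces to Laplace transforms along the
  axes.\<close>

lemma exp_norm_le_sum_exp_inner:
  fixes a :: "'a::euclidean_space"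
  assumes "0 \<le> r"
  shows "exp (r / DIM('a) * norm a)
    \<le> (\<Sum>b\<in>Basis. exp (r * (a \<bullet> b)) + exp (- r * (a \<bullet> b)))"
proof -
  obtain b :: 'a where b: "b \<in> Basis" "\<And>b'. b' \<in> Basis \<Longrightarrow> \<bar>a \<bullet> b'\<bar> \<le> \<bar>a \<bullet> b\<bar>"
    using obtains_MAX[OF finite_Basis nonempty_Basis, of "\<lambda>b. \<bar>a \<bullet> b\<bar>"] Max_ge
    by (metis (no_types, lifting) finite_Basis finite_imageI imageI)
  have "norm a \<le> (\<Sum>b'\<in>Basis. \<bar>a \<bullet> b'\<bar>)" by (rule norm_le_l1)
  also have "\<dots> \<le> DIM('a) * \<bar>a \<bullet> b\<bar>" using sum_bounded_above[of Basis "\<lambda>b'. \<bar>a \<bullet> b'\<bar>", OF b(2)] by simp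
  finally have "norm a / DIM('a) \<le> \<bar>a \<bullet> b\<bar>" by (simp add: field_simps)
  then have "r * (norm a / DIM('a)) \<le> r * \<bar>a \<bullet> b\<bar>" using assms by (rule mult_left_mono)
  then have "exp (r / DIM('a) * norm a) \<le> exp (r * \<bar>a \<bullet> b\<bar>)" by simp
  also have "\<dots> \<le> exp (r * (a \<bullet> b)) + exp (- r * (a \<bullet> b))"
    by (cases "0 \<le> a \<bullet> b") (auto simp: abs_if)
  also have "\<dots> \<le> (\<Sum>b\<in>Basis. exp (r * (a \<bullet> b)) + exp (- r * (a \<bullet> b)))"
    using b(1) by (intro member_le_sum) (auto intro: add_nonneg_nonneg)
  finally show ?thesis .
qed

text \<open>For u = 1 the kernel is exp(a . x - |x|^2 / 2), so the assumption says that the Laplace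
  transform of \<open>\<mu>\<close> is finite on a ball of radius d. Evaluating it at plus and minus
  (d/2) b for basis vectors b bounds an exponential moment of the norm.\<close>

lemma bridge_exp_integrable_origin:
  fixes \<mu> :: "'a::euclidean_space measure"
  assumes [measurable_cong]: "sets \<mu> = sets borel"
    and ev: "\<forall>\<^sub>F x in nhds 0. integrable \<mu> (bridge_density 1 x)"
  shows "bridge_exp_integrable \<mu> 1 0"
proof -
  obtain d where "0 < d" and d: "\<And>x. norm x < d \<Longrightarrow> integrable \<mu> (bridge_density 1 x)"
    using ev by (auto simp: eventually_nhds_metric dist_norm)
  have b0: "bridge_density 1 0 a = 1" for a :: 'a
    using gauss_density_pos[of 1 a] by (simp add: bridge_density_def)
  have ix: "integrable \<mu> (\<lambda>a. exp (a \<bullet> x))" if "norm x < d" for x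
  proof -
    have "bridge_density 1 x a * exp ((norm x)\<^sup>2 / 2) = exp (a \<bullet> x)" for a
      using bridge_density_shift[of 1 x a 0] by (simp add: b0 exp_minus field_simps)
    with integrable_mult_left[OF d[OF that], of "exp ((norm x)\<^sup>2 / 2)"] show ?thesis by simp
  qed
  have "integrable \<mu> (\<lambda>a. \<Sum>b\<in>Basis. exp (d / 2 * (a \<bullet> b)) + exp (- (d / 2) * (a \<bullet> b)))"
  proof (intro Bochner_Integration.integrable_sum Bochner_Integration.integrable_add)
    fix b :: 'a assume "b \<in> Basis"
    with ix[of "(d / 2) *\<^sub>R b"] ix[of "(- (d / 2)) *\<^sub>R b"] \<open>0 < d\<close>
    show "integrable \<mu> (\<lambda>a. exp (d / 2 * (a \<bullet> b)))" "integrable \<mu> (\<lambda>a. exp (- (d / 2) * (a \<bullet> b)))"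
      by simp_all
  qed
  then have "integrable \<mu> (\<lambda>a. exp (d / 2 / DIM('a) * norm a))"
  proof (rule Bochner_Integration.integrable_bound)
    show "AE a in \<mu>. norm (exp (d / 2 / DIM('a) * norm a))
      \<le> norm (\<Sum>b\<in>Basis. exp (d / 2 * (a \<bullet> b)) + exp (- (d / 2) * (a \<bullet> b)))"
      using exp_norm_le_sum_exp_inner[of "d / 2"] \<open>0 < d\<close>
      by (auto intro: order_trans[OF _ abs_ge_self])
  qed simp
  then show ?thesis
    unfolding bridge_exp_integrable_def using \<open>0 < d\<close>
    by (intro exI[of _ "d / 2 / DIM('a)"]) (auto simp: b0)
qed

text \<open>The Laplace transform facts, applied to X = (a - y) / u with weight h(a) p(y,a). A
  bounded h preserves the exponential moment, which is what allows both h = 1 and tilts of the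
  policy.\<close>

lemma
  fixes \<mu> :: "'a::euclidean_space measure"
  assumes [measurable_cong]: "sets \<mu> = sets borel" and "0 < u"
    and \<mu>: "bridge_exp_integrable \<mu> u y"
    and h[measurable]: "h \<in> borel_measurable borel" and hC: "\<And>a. \<bar>h a\<bar> \<le> C"
  shows integrable_bridge: "integrable \<mu> (\<lambda>a. h a * bridge_density u y a)"
    and integrable_bridge_scaleR:
      "integrable \<mu> (\<lambda>a. (h a * bridge_density u y a) *\<^sub>R ((1 / u) *\<^sub>R (a - y)))"
    and GDERIV_bridge_integral:
      "GDERIV (\<lambda>x. \<integral>a. h a * bridge_density u x a \<partial>\<mu>) y
        :> (\<integral>a. (h a * bridge_density u y a) *\<^sub>R ((1 / u) *\<^sub>R (a - y)) \<partial>\<mu>)"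
proof -
  let ?p = "bridge_density u" and ?X = "\<lambda>a. (1 / u) *\<^sub>R (a - y)"
  obtain \<delta> where "0 < \<delta>" and \<delta>: "integrable \<mu> (\<lambda>a. ?p y a * exp (\<delta> * norm (?X a)))"
    using \<mu> by (auto simp: bridge_exp_integrable_def)
  have i: "integrable \<mu> (\<lambda>a. (h a * ?p y a) * exp (\<delta> * norm (?X a)))"
  proof (rule Bochner_Integration.integrable_bound[OF integrable_mult_right[OF \<delta>, of C]])
    have "\<bar>h a\<bar> * (?p y a * exp (\<delta> * norm (?X a))) \<le> C * (?p y a * exp (\<delta> * norm (?X a)))" for a
      using bridge_density_pos[OF \<open>0 < u\<close>, of y a] by (intro mult_right_mono hC) auto
    then show "AE a in \<mu>. norm ((h a * ?p y a) * exp (\<delta> * norm (?X a)))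
        \<le> norm (C * (?p y a * exp (\<delta> * norm (?X a))))"
      using bridge_density_pos[OF \<open>0 < u\<close>, of y]
      by (auto simp: abs_mult mult.assoc less_imp_le simp del: norm_scaleR
          intro!: AE_I2 intro: order_trans[OF hC abs_ge_self])
  qed measurable
  have [measurable]: "(\<lambda>a. h a * ?p y a) \<in> borel_measurable \<mu>" "?X \<in> borel_measurable \<mu>"
    by measurable
  show "integrable \<mu> (\<lambda>a. h a * ?p y a)"
    by (rule integrable_of_exp_moment[OF _ _ \<open>0 < \<delta>\<close> i]) measurable
  show "integrable \<mu> (\<lambda>a. (h a * ?p y a) *\<^sub>R ?X a)"
    by (rule integrable_scaleR_of_exp_moment[OF _ _ \<open>0 < \<delta>\<close> i]) measurable
  define F where "F = (\<lambda>v. \<integral>a. (h a * ?p y a) * exp (?X a \<bullet> v) \<partial>\<mu>)"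
  define G where "G = (\<integral>a. (h a * ?p y a) *\<^sub>R ?X a \<partial>\<mu>)"
  have "(F has_derivative (\<lambda>v. v \<bullet> G)) (at 0)"
    using laplace_GDERIV[OF _ _ \<open>0 < \<delta>\<close> i] by (simp add: gderiv_def F_def G_def)
  then have D: "((\<lambda>x. F (x - y)) has_derivative (\<lambda>v. v \<bullet> G)) (at y)"
    by (intro has_derivative_compose[where f="\<lambda>x. x - y" and g=F, simplified])
       (auto intro!: derivative_eq_intros)
  \<comment> \<open>The factor free of a equals 1 at x = y and has zero derivative there, so the
    product rule leaves the gradient \<open>G\<close> of the Laplace transform unchanged.\<close>
  have E: "((\<lambda>x. exp (- (norm (x - y))\<^sup>2 / (2 * u))) has_derivative (\<lambda>v. 0)) (at y)"
    unfolding power2_norm_eq_inner using \<open>0 < u\<close>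
    by (auto intro!: derivative_eq_intros simp: fun_eq_iff)
  have eq: "(\<integral>a. h a * ?p x a \<partial>\<mu>) = F (x - y) * exp (- (norm (x - y))\<^sup>2 / (2 * u))" for x
    unfolding F_def bridge_density_shift[OF \<open>0 < u\<close>, of x _ y]
    by (simp add: mult.assoc[symmetric])
  have "((\<lambda>x. F (x - y) * exp (- (norm (x - y))\<^sup>2 / (2 * u))) has_derivative (\<lambda>v. v \<bullet> G)) (at y)"
    using has_derivative_mult[OF D E] by simp
  then show "GDERIV (\<lambda>x. \<integral>a. h a * ?p x a \<partial>\<mu>) y :> (\<integral>a. (h a * ?p y a) *\<^sub>R ?X a \<partial>\<mu>)"
    unfolding gderiv_def eq G_def .
qed

section \<open>Uniqueness of the conditional law at a point\<close>

text \<open>Indicators of closed sets are limits of the bounded continuous functions max(0, 1 - n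
  dist(x, F)), and closed sets form an intersection-stable generator of the Borel sets.\<close>

lemma measure_eqI_bounded_continuous:
  fixes M N :: "'a::metric_space measure"
  assumes "prob_space M" "prob_space N" and [measurable_cong]: "sets M = sets borel" "sets N = sets borel"
    and eq: "\<And>g::'a \<Rightarrow> real. continuous_on UNIV g \<Longrightarrow> bounded (range g) \<Longrightarrow> (\<integral>x. g x \<partial>M) = (\<integral>x. g x \<partial>N)"
  shows "M = N"
proof -
  interpret M: prob_space M by fact
  interpret N: prob_space N by fact
  have closed: "measure M F = measure N F" if F: "closed F" for F
  \<comment> \<open>\<open>infdist x {}\<close> is 0 by convention, so for empty F the approximating
    functions would be constantly 1.\<close>
  proof (cases "F = {}")
    case False
    define g where "g = (\<lambda>n x. max 0 (1 - real n * infdist x F))"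
    have g: "continuous_on UNIV (g n)" for n
      unfolding g_def by (intro continuous_intros)
    then have [measurable]: "g n \<in> borel_measurable borel" for n
      by (rule borel_measurable_continuous_onI)
    have [measurable]: "F \<in> sets borel" using F by simp
    have g01: "\<bar>g n x\<bar> \<le> 1" for n x by (simp add: g_def infdist_nonneg)
    have lim: "(\<lambda>n. g n x) \<longlonglongrightarrow> indicator F x" for x
    proof (cases "x \<in> F")
      case True
      then show ?thesis by (simp add: g_def)
    next
      case False
      then have pos: "0 < infdist x F"
        using in_closed_iff_infdist_zero[OF F \<open>F \<noteq> {}\<close>] infdist_nonneg[of x F] by force
      obtain n0 :: nat where "1 / infdist x F < n0" using reals_Archimedean2 by blast
      then have "g n x = 0" if "n0 \<le> n" for n
      proof -
        have "1 / infdist x F \<le> n" using \<open>1 / infdist x F < n0\<close> that by linarith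
        then show ?thesis using pos by (simp add: g_def field_simps)
      qed
      then have "\<forall>\<^sub>F n in sequentially. g n x = indicator F x"
        using False by (auto simp: eventually_sequentially)
      then show ?thesis by (rule tendsto_eventually)
    qed
    have "(\<lambda>n. \<integral>x. g n x \<partial>M) \<longlonglongrightarrow> (\<integral>x. indicator F x \<partial>M)"
      by (rule integral_dominated_convergence[where w="\<lambda>_. 1"]) (use lim g01 in auto)
    moreover have "(\<lambda>n. \<integral>x. g n x \<partial>N) \<longlonglongrightarrow> (\<integral>x. indicator F x \<partial>N)"
      by (rule integral_dominated_convergence[where w="\<lambda>_. 1"]) (use lim g01 in auto)
    moreover have "(\<integral>x. g n x \<partial>M) = (\<integral>x. g n x \<partial>N)" for n
      using g g01 by (intro eq) (auto simp: bounded_iff)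
    ultimately have "(\<integral>x. indicator F x \<partial>M) = (\<integral>x. indicator F x \<partial>N :: real)"
      using LIMSEQ_unique by fastforce
    then show ?thesis by simp
  qed simp
  show ?thesis
  proof (rule measure_eqI_generator_eq[where E="Collect closed" and \<Omega>=UNIV and A="\<lambda>_. UNIV"])
    show "sets M = sigma_sets UNIV (Collect closed)" "sets N = sigma_sets UNIV (Collect closed)"
      using assms(3,4) by (simp_all add: borel_eq_closed)
    show "emeasure M X = emeasure N X" if "X \<in> Collect closed" for X
      using closed that by (simp add: M.emeasure_eq_measure N.emeasure_eq_measure)
  qed (auto simp: Int_stable_def)
qed

text \<open>Both conditional integrals are densities of the same measure relative to the law of X,
  and densities are unique almost everywhere. The exceptional null set may depend on g.\<close>

lemma regular_cond_dist_AE_integral_eq: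
  fixes \<kappa> \<kappa>' :: "'b \<Rightarrow> 'c measure" and g :: "'c \<Rightarrow> real"
  assumes M: "prob_space M" and X[measurable]: "X \<in> M \<rightarrow>\<^sub>M S"
    and \<kappa>: "regular_cond_dist M S N X Z \<kappa>" and \<kappa>': "regular_cond_dist M S N X Z \<kappa>'"
    and g[measurable]: "g \<in> borel_measurable N" and gC: "\<And>a. \<bar>g a\<bar> \<le> C"
  shows "AE x in distr M S X. (\<integral>a. g a \<partial>\<kappa> x) = (\<integral>a. g a \<partial>\<kappa>' x)"
proof -
  define D where "D = distr M S X"
  interpret D: prob_space D unfolding D_def by (rule prob_space.prob_space_distr[OF M X])
  have [measurable_cong]: "sets D = sets S" by (simp add: D_def)
  have \<kappa>_meas: "\<kappa> \<in> D \<rightarrow>\<^sub>M prob_algebra N" "\<kappa>' \<in> D \<rightarrow>\<^sub>M prob_algebra N"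
    using \<kappa> \<kappa>' by (auto simp: regular_cond_dist_def D_def)
  note [measurable] = \<kappa>_meas[THEN measurable_prob_algebraD]
  have kernel: "prob_space (\<kappa> x)" "prob_space (\<kappa>' x)" "sets (\<kappa> x) = sets N" "sets (\<kappa>' x) = sets N"
    if "x \<in> space D" for x
    using measurable_space[OF \<kappa>_meas(1) that] measurable_space[OF \<kappa>_meas(2) that]
    by (auto simp: space_prob_algebra)
  \<comment> \<open>Shifting by the bound C makes the integrand nonnegative, so that the comparison
    can be made with extended nonnegative integrals; the shift is undone at the end.\<close>
  define h where "h = (\<lambda>a. ennreal (g a + C))"
  have [measurable]: "h \<in> borel_measurable N" by (simp add: h_def)
  have "density D (\<lambda>x. \<integral>\<^sup>+a. h a \<partial>\<kappa> x) = density D (\<lambda>x. \<integral>\<^sup>+a. h a \<partial>\<kappa>' x)"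
  proof (rule measure_eqI)
    fix B assume "B \<in> sets (density D (\<lambda>x. \<integral>\<^sup>+a. h a \<partial>\<kappa> x))"
    then have B[measurable]: "B \<in> sets S" by (simp add: D_def)
    \<comment> \<open>\<open>E\<close> is the law of X restricted to B. Binding it with either
      kernel gives the measure sending A to the probability that X is in B and Z in A, so the two
      bindings coincide.\<close>
    define E where "E = density D (\<lambda>x. indicator B x)"
    have [measurable_cong]: "sets E = sets S" by (simp add: E_def D_def)
    have E: "space E \<noteq> {}" using D.not_empty by (simp add: E_def)
    have mE: "\<kappa> \<in> E \<rightarrow>\<^sub>M subprob_algebra N" "\<kappa>' \<in> E \<rightarrow>\<^sub>M subprob_algebra N"
      by (measurable; fact)+
    have "E \<bind> \<kappa> = E \<bind> \<kappa>'"
    proof (rule measure_eqI)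
      show "sets (E \<bind> \<kappa>) = sets (E \<bind> \<kappa>')"
        using E kernel by (subst (1 2) sets_bind[where N=N]) (auto simp: E_def)
      fix A assume "A \<in> sets (E \<bind> \<kappa>)"
      then have A[measurable]: "A \<in> sets N"
        using E kernel by (subst (asm) sets_bind[where N=N]) (auto simp: E_def)
      have "emeasure (E \<bind> k) A = emeasure M {w \<in> space M. X w \<in> B \<and> Z w \<in> A}"
        if k: "regular_cond_dist M S N X Z k" and [measurable]: "k \<in> D \<rightarrow>\<^sub>M subprob_algebra N"
          and "k \<in> E \<rightarrow>\<^sub>M subprob_algebra N" for k
      proof -
        have "emeasure (E \<bind> k) A = (\<integral>\<^sup>+x. emeasure (k x) A \<partial>E)"
          by (rule emeasure_bind[OF E that(3) A])
        also have "\<dots> = (\<integral>\<^sup>+x. emeasure (k x) A * indicator B x \<partial>D)"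
          unfolding E_def by (subst nn_integral_density) (auto simp: mult.commute)
        finally show ?thesis using k A B by (simp add: regular_cond_dist_def D_def)
      qed
      from this[OF \<kappa> _ mE(1)] this[OF \<kappa>' _ mE(2)]
      show "emeasure (E \<bind> \<kappa>) A = emeasure (E \<bind> \<kappa>') A" by simp
    qed
    then have "(\<integral>\<^sup>+x. \<integral>\<^sup>+a. h a \<partial>\<kappa> x \<partial>E) = (\<integral>\<^sup>+x. \<integral>\<^sup>+a. h a \<partial>\<kappa>' x \<partial>E)"
      using nn_integral_bind[OF _ mE(1), of h] nn_integral_bind[OF _ mE(2), of h] by simp
    then show "emeasure (density D (\<lambda>x. \<integral>\<^sup>+a. h a \<partial>\<kappa> x)) B
        = emeasure (density D (\<lambda>x. \<integral>\<^sup>+a. h a \<partial>\<kappa>' x)) B"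
      unfolding E_def
      by (subst (asm) (1 2) nn_integral_density) (auto simp: emeasure_density mult.commute)
  qed simp
  then have "AE x in D. (\<integral>\<^sup>+a. h a \<partial>\<kappa> x) = (\<integral>\<^sup>+a. h a \<partial>\<kappa>' x)"
    by (subst (asm) D.density_unique_iff) auto
  with AE_space show ?thesis
    unfolding D_def[symmetric]
  proof eventually_elim
    case (elim x)
    have "(\<integral>\<^sup>+a. h a \<partial>k) = ennreal ((\<integral>a. g a \<partial>k) + C)" "0 \<le> (\<integral>a. g a \<partial>k) + C"
      if "prob_space k" and [measurable_cong]: "sets k = sets N" for k
    proof -
      interpret k: prob_space k by fact
      have ig: "integrable k g" by (rule k.integrable_const_bound[where B=C]) (use gC in auto)
      have nn: "0 \<le> g a + C" for a using gC[of a] by linarith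
      have eq: "(\<integral>a. g a + C \<partial>k) = (\<integral>a. g a \<partial>k) + C" using ig by (simp add: k.prob_space)
      show "(\<integral>\<^sup>+a. h a \<partial>k) = ennreal ((\<integral>a. g a \<partial>k) + C)"
        unfolding h_def eq[symmetric] by (rule nn_integral_eq_integral) (use ig nn in auto)
      show "0 \<le> (\<integral>a. g a \<partial>k) + C"
        unfolding eq[symmetric] by (rule integral_nonneg_AE) (use nn in auto)
    qed
    from this[of "\<kappa> x"] this[of "\<kappa>' x"] kernel[OF elim(1)] elim(2) show ?case by simp
  qed
qed

text \<open>For a fixed test function g, the difference of the integrals under two versions vanishes
  almost everywhere and is continuous at y. Were it nonzero at y, it would be nonzero on an open
  neighbourhood, which has positive mass. Since one g is treated at a time, null sets depending on g
  do no harm.\<close>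

lemma cond_law_eqI:
  fixes X Z :: "'w \<Rightarrow> 'a::euclidean_space"
  assumes M: "prob_space M" and X: "X \<in> borel_measurable M"
    and supp: "\<And>U. open U \<Longrightarrow> y \<in> U \<Longrightarrow> emeasure (distr M borel X) U \<noteq> 0"
    and \<kappa>: "regular_cond_dist M borel borel X Z \<kappa>"
    and cont: "\<And>g::'a \<Rightarrow> real. continuous_on UNIV g \<Longrightarrow> bounded (range g) \<Longrightarrow>
      isCont (\<lambda>x. \<integral>a. g a \<partial>\<kappa> x) y"
  shows "cond_law M X Z y = \<kappa> y"
  unfolding cond_law_def
proof (rule the_equality)
  show "\<exists>\<kappa>'. regular_cond_dist M borel borel X Z \<kappa>' \<and> \<kappa>' y = \<kappa> y \<and>
      (\<forall>g::'a \<Rightarrow> real. continuous_on UNIV g \<and> bounded (range g) \<longrightarrow> isCont (\<lambda>x. \<integral>a. g a \<partial>\<kappa>' x) y)"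
    using \<kappa> cont by blast
next
  fix \<mu>
  assume "\<exists>\<kappa>'. regular_cond_dist M borel borel X Z \<kappa>' \<and> \<kappa>' y = \<mu> \<and>
      (\<forall>g::'a \<Rightarrow> real. continuous_on UNIV g \<and> bounded (range g) \<longrightarrow> isCont (\<lambda>x. \<integral>a. g a \<partial>\<kappa>' x) y)"
  then obtain \<kappa>' where \<kappa>': "regular_cond_dist M borel borel X Z \<kappa>'" and \<mu>: "\<kappa>' y = \<mu>"
    and cont': "\<And>g::'a \<Rightarrow> real. continuous_on UNIV g \<Longrightarrow> bounded (range g) \<Longrightarrow>
      isCont (\<lambda>x. \<integral>a. g a \<partial>\<kappa>' x) y"
    by blast
  have kernel: "prob_space (k y)" "sets (k y) = sets borel"
    if "regular_cond_dist M borel borel X Z k" for k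
  proof -
    have "k \<in> borel \<rightarrow>\<^sub>M prob_algebra borel" using that by (simp add: regular_cond_dist_def)
    from measurable_space[OF this, of y] show "prob_space (k y)" "sets (k y) = sets borel"
      by (auto simp: space_prob_algebra)
  qed
  show "\<mu> = \<kappa> y"
    unfolding \<mu>[symmetric]
  proof (rule measure_eqI_bounded_continuous[OF kernel(1)[OF \<kappa>'] kernel(1)[OF \<kappa>]
        kernel(2)[OF \<kappa>'] kernel(2)[OF \<kappa>]])
    fix g :: "'a \<Rightarrow> real" assume g: "continuous_on UNIV g" "bounded (range g)"
    obtain C where C: "\<And>a. \<bar>g a\<bar> \<le> C" using g(2) by (auto simp: bounded_iff)
    define e where "e = (\<lambda>x. (\<integral>a. g a \<partial>\<kappa>' x) - (\<integral>a. g a \<partial>\<kappa> x))"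
    have "isCont e y" unfolding e_def using cont[OF g] cont'[OF g] by (intro continuous_intros)
    have AE: "AE x in distr M borel X. e x = 0"
      using regular_cond_dist_AE_integral_eq[OF M X \<kappa>' \<kappa> borel_measurable_continuous_onI[OF g(1)] C]
      by (simp add: e_def)
    have "e y = 0"
    proof (rule ccontr)
      assume "e y \<noteq> 0"
      with \<open>isCont e y\<close> have "\<forall>\<^sub>F x in nhds y. e x \<noteq> 0"
        using tendsto_imp_eventually_ne[of e "e y" "nhds y" 0]
        by (simp add: isCont_def tendsto_at_iff_tendsto_nhds)
      then obtain U where U: "open U" "y \<in> U" "\<And>x. x \<in> U \<Longrightarrow> e x \<noteq> 0"
        by (auto simp: eventually_nhds)
      from AE have "AE x in distr M borel X. x \<notin> U" by eventually_elim (use U in auto)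
      then have "emeasure (distr M borel X) U = 0"
        using U(1) by (subst (asm) AE_iff_measurable[of U]) auto
      with supp[OF U(1,2)] show False by simp
    qed
    then show "(\<integral>a. g a \<partial>\<kappa>' y) = (\<integral>a. g a \<partial>\<kappa> y)" by (simp add: e_def)
  qed
qed

section \<open>The candidate conditional law: moments, gradient of conditional expectations,
  drifts\<close>

text \<open>Bayes' formula for the law of Y_1 given that Y at time 1 - u is x. The factor
  \<open>gauss_density (1 - u) x\<close> left out of \<open>bridge_density\<close> would cancel in
  this quotient.\<close>

definition bridge_cond :: "'a::euclidean_space measure \<Rightarrow> real \<Rightarrow> 'a \<Rightarrow> 'a measure" where
  "bridge_cond \<mu> u x = density \<mu> (\<lambda>a. ennreal (bridge_density u x a / (\<integral>a'. bridge_density u x a' \<partial>\<mu>)))"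

lemma (in prob_space) expectation_pos:
  fixes f :: "'a \<Rightarrow> real"
  assumes f: "integrable M f" "\<And>x. 0 < f x"
  shows "0 < expectation f"
proof -
  have "expectation f \<noteq> 0"
  proof
    assume "expectation f = 0"
    then have "AE x in M. f x = 0"
      using f by (subst (asm) integral_nonneg_eq_0_iff_AE) (auto simp: less_imp_le)
    then have "AE x in M. False" by eventually_elim (metis f(2) less_irrefl)
    then show False by simp
  qed
  moreover have "0 \<le> expectation f"
    using f by (intro integral_nonneg_AE) (auto simp: less_imp_le)
  ultimately show ?thesis by simp
qed

lemma sets_bridge_cond [simp, measurable_cong]: "sets (bridge_cond \<mu> u x) = sets \<mu>"
  by (simp add: bridge_cond_def)

text \<open>The integral formula holds at every x: if the normalising integral is 0, in particular
  by the convention for non-integrable functions, both sides are 0 as division by 0 gives 0. Hence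
  it can be used in a whole neighbourhood of y when the exponential moment is known at y
  alone.\<close>

lemma
  fixes h :: "'a::euclidean_space \<Rightarrow> 'b::{banach, second_countable_topology}"
  assumes [measurable_cong]: "sets \<mu> = sets borel" and "0 < u" and [measurable]: "h \<in> borel_measurable borel"
  shows integral_bridge_cond: "(\<integral>a. h a \<partial>bridge_cond \<mu> u x)
        = (1 / (\<integral>a. bridge_density u x a \<partial>\<mu>)) *\<^sub>R (\<integral>a. bridge_density u x a *\<^sub>R h a \<partial>\<mu>)"
    and integrable_bridge_cond: "integrable \<mu> (\<lambda>a. bridge_density u x a *\<^sub>R h a) \<Longrightarrow>
      integrable (bridge_cond \<mu> u x) h"
proof -
  let ?H = "\<integral>a. bridge_density u x a \<partial>\<mu>"
  have "0 \<le> ?H"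
    using bridge_density_pos[OF \<open>0 < u\<close>, of x] by (intro integral_nonneg_AE) (auto simp: less_imp_le)
  then have p: "0 \<le> bridge_density u x a / ?H" for a
    using bridge_density_pos[OF \<open>0 < u\<close>, of x a] by simp
  have e: "(bridge_density u x a / ?H) *\<^sub>R h a = (1 / ?H) *\<^sub>R (bridge_density u x a *\<^sub>R h a)" for a
    by simp
  show "(\<integral>a. h a \<partial>bridge_cond \<mu> u x) = (1 / ?H) *\<^sub>R (\<integral>a. bridge_density u x a *\<^sub>R h a \<partial>\<mu>)"
    unfolding bridge_cond_def
    by (subst integral_density) (use p in \<open>auto simp: e simp del: scaleR_scaleR\<close>)
  assume "integrable \<mu> (\<lambda>a. bridge_density u x a *\<^sub>R h a)"
  then show "integrable (bridge_cond \<mu> u x) h"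
    unfolding bridge_cond_def
    by (subst integrable_density) (use p in \<open>auto simp: e simp del: scaleR_scaleR\<close>)
qed

context
  fixes \<mu> :: "'a::euclidean_space measure" and u :: real and y :: 'a
  assumes prob: "prob_space \<mu>" and sets[measurable_cong]: "sets \<mu> = sets borel" and u: "0 < u"
    and bei: "bridge_exp_integrable \<mu> u y"
begin

lemma integrable_bridge_density: "integrable \<mu> (bridge_density u y)"
  using integrable_bridge[OF sets u bei, of "\<lambda>_. 1" 1] by simp

lemma bridge_integral_pos: "0 < (\<integral>a. bridge_density u y a \<partial>\<mu>)"
  by (rule prob_space.expectation_pos[OF prob integrable_bridge_density bridge_density_pos[OF u]])

lemma prob_space_bridge_cond: "prob_space (bridge_cond \<mu> u y)"
proof (rule prob_spaceI)
  let ?H = "\<integral>a. bridge_density u y a \<partial>\<mu>"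
  have "emeasure (bridge_cond \<mu> u y) (space (bridge_cond \<mu> u y))
      = (\<integral>\<^sup>+a. ennreal (bridge_density u y a / ?H) \<partial>\<mu>)"
    unfolding bridge_cond_def by (subst emeasure_density) (auto intro!: nn_integral_cong)
  also have "\<dots> = ennreal (\<integral>a. bridge_density u y a / ?H \<partial>\<mu>)"
    using integrable_bridge_density bridge_integral_pos bridge_density_pos[OF u, of y]
    by (intro nn_integral_eq_integral) (auto simp: less_imp_le)
  also have "\<dots> = 1" using bridge_integral_pos by simp
  finally show "emeasure (bridge_cond \<mu> u y) (space (bridge_cond \<mu> u y)) = 1" .
qed

lemma integrable_bridge_cond_id: "integrable (bridge_cond \<mu> u y) (\<lambda>a. a)"
proof -
  \<comment> \<open>Writes a = u X + y with X = (a - y) / u, for which integrability is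
    known.\<close>
  have "integrable \<mu> (\<lambda>a. u *\<^sub>R (bridge_density u y a *\<^sub>R ((1 / u) *\<^sub>R (a - y))) + bridge_density u y a *\<^sub>R y)"
    using integrable_bridge_scaleR[OF sets u bei, of "\<lambda>_. 1" 1] integrable_bridge_density
    by (intro Bochner_Integration.integrable_add integrable_scaleR_right integrable_scaleR_left)
      (simp_all only: mult_1_left borel_measurable_const abs_one order_refl)
  then show ?thesis
    using u by (intro integrable_bridge_cond[OF sets u]) (simp_all add: algebra_simps)
qed

context
  fixes g :: "'a \<Rightarrow> real" and C :: real
  assumes g[measurable]: "g \<in> borel_measurable borel" and gC: "\<And>a. \<bar>g a\<bar> \<le> C"
begin

lemma integrable_bridge_cond_bounded: "integrable (bridge_cond \<mu> u y) g"
  using integrable_bridge[OF sets u bei g gC]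
  by (intro integrable_bridge_cond[OF sets u]) (simp_all add: mult.commute)

lemma integrable_bridge_cond_scaleR: "integrable (bridge_cond \<mu> u y) (\<lambda>a. g a *\<^sub>R a)"
proof -
  have "integrable \<mu> (\<lambda>a. u *\<^sub>R ((g a * bridge_density u y a) *\<^sub>R ((1 / u) *\<^sub>R (a - y)))
      + (g a * bridge_density u y a) *\<^sub>R y)"
    using integrable_bridge_scaleR[OF sets u bei g gC] integrable_bridge[OF sets u bei g gC]
    by (intro Bochner_Integration.integrable_add integrable_scaleR_right integrable_scaleR_left) auto
  then show ?thesis
    using u by (intro integrable_bridge_cond[OF sets u]) (simp_all add: algebra_simps)
qed

text \<open>The quotient rule gives E[g X] - E[g] E[X] under the conditional law. As X = (a - y) / u
  is affine in a, the shift by y drops out and the factor 1/u comes forward. Besides the gradient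
  form of the expansion, this supplies weak continuity of \<open>bridge_cond\<close>.\<close>

lemma GDERIV_bridge_cond_integral:
  "GDERIV (\<lambda>x. \<integral>a. g a \<partial>bridge_cond \<mu> u x) y :> (1 / u) *\<^sub>R cov_id (bridge_cond \<mu> u y) g"
proof -
  let ?\<nu> = "bridge_cond \<mu> u y" and ?p = "bridge_density u" and ?X = "\<lambda>a. (1 / u) *\<^sub>R (a - y)"
  interpret \<nu>: prob_space ?\<nu> by (rule prob_space_bridge_cond)
  define H where "H = (\<lambda>x. \<integral>a. ?p x a \<partial>\<mu>)"
  define N where "N = (\<lambda>x. \<integral>a. g a * ?p x a \<partial>\<mu>)"
  define GH where "GH = (\<integral>a. ?p y a *\<^sub>R ?X a \<partial>\<mu>)"
  define GN where "GN = (\<integral>a. (g a * ?p y a) *\<^sub>R ?X a \<partial>\<mu>)"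
  have "0 < H y" unfolding H_def by (rule bridge_integral_pos)
  have H: "(H has_derivative (\<lambda>v. v \<bullet> GH)) (at y)"
    using GDERIV_bridge_integral[OF sets u bei, of "\<lambda>_. 1" 1] by (simp add: gderiv_def H_def GH_def)
  have N: "(N has_derivative (\<lambda>v. v \<bullet> GN)) (at y)"
    using GDERIV_bridge_integral[OF sets u bei g gC] by (simp add: gderiv_def N_def GN_def)
  have eq: "(\<integral>a. g a \<partial>bridge_cond \<mu> u x) = N x / H x" for x
    by (subst integral_bridge_cond[OF sets u g]) (simp add: N_def H_def mult.commute)
  have id: "integrable ?\<nu> (\<lambda>a. a)" and ig: "integrable ?\<nu> g" and iga: "integrable ?\<nu> (\<lambda>a. g a *\<^sub>R a)"
    by (rule integrable_bridge_cond_id integrable_bridge_cond_bounded integrable_bridge_cond_scaleR)+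
  define m where "m = (\<integral>a. a \<partial>?\<nu>)"
  define e where "e = (\<integral>a. g a \<partial>?\<nu>)"
  define c where "c = (\<integral>a. g a *\<^sub>R a \<partial>?\<nu>)"
  have cov: "cov_id ?\<nu> g = c - e *\<^sub>R m"
  proof -
    have "cov_id ?\<nu> g = (\<integral>a. (g a *\<^sub>R a - g a *\<^sub>R m) - (e *\<^sub>R a - e *\<^sub>R m) \<partial>?\<nu>)"
      unfolding cov_id_def m_def[symmetric] e_def[symmetric] by (simp add: algebra_simps)
    also have "\<dots> = (c - e *\<^sub>R m) - (e *\<^sub>R m - e *\<^sub>R m)"
      using id ig iga by (simp add: c_def e_def m_def \<nu>.prob_space)
    finally show ?thesis by simp
  qed
  have GH: "(1 / H y) *\<^sub>R GH = (1 / u) *\<^sub>R (m - y)"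
  proof -
    have "(1 / H y) *\<^sub>R GH = (\<integral>a. ?X a \<partial>?\<nu>)"
      unfolding H_def GH_def by (rule integral_bridge_cond[OF sets u, symmetric]) simp
    then show ?thesis using id by (simp add: m_def \<nu>.prob_space)
  qed
  have GN: "(1 / H y) *\<^sub>R GN = (1 / u) *\<^sub>R (c - e *\<^sub>R y)"
  proof -
    have "(1 / H y) *\<^sub>R GN = (\<integral>a. g a *\<^sub>R ?X a \<partial>?\<nu>)"
      unfolding H_def GN_def
      by (subst integral_bridge_cond[OF sets u]) (simp_all add: mult.commute)
    also have "\<dots> = (\<integral>a. (1 / u) *\<^sub>R (g a *\<^sub>R a - g a *\<^sub>R y) \<partial>?\<nu>)"
      by (simp add: algebra_simps)
    also have "\<dots> = (1 / u) *\<^sub>R (c - e *\<^sub>R y)"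
      using ig iga by (simp add: c_def e_def)
    finally show ?thesis .
  qed
  have "((\<lambda>x. N x / H x) has_derivative
      (\<lambda>v. - N y * (inverse (H y) * (v \<bullet> GH) * inverse (H y)) + (v \<bullet> GN) / H y)) (at y)"
    using has_derivative_divide[OF N H] \<open>0 < H y\<close> by simp
  moreover have "- N y * (inverse (H y) * (v \<bullet> GH) * inverse (H y)) + (v \<bullet> GN) / H y
      = v \<bullet> ((1 / u) *\<^sub>R cov_id ?\<nu> g)" for v
  proof -
    have "- N y * (inverse (H y) * (v \<bullet> GH) * inverse (H y)) + (v \<bullet> GN) / H y
        = v \<bullet> ((1 / H y) *\<^sub>R GN) - e * (v \<bullet> ((1 / H y) *\<^sub>R GH))"
      using eq[of y] by (simp add: e_def divide_inverse)
    also have "\<dots> = v \<bullet> ((1 / u) *\<^sub>R cov_id ?\<nu> g)"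
      unfolding GH GN cov by (simp add: inner_diff_right algebra_simps)
    finally show ?thesis .
  qed
  ultimately show ?thesis unfolding gderiv_def eq by simp
qed

end

text \<open>One formula for both drifts: h = 1 gives the reference drift, and the normalised tilt
  exp(A / lambda) / Z gives the updated one. It is the logarithmic derivative of the heat
  integral.\<close>

lemma sf_drift_density:
  assumes "absolutely_continuous std_gaussian \<mu>" and t: "u = 1 - t"
    and h[measurable]: "h \<in> borel_measurable borel" and "\<And>a. 0 < h a" and hC: "\<And>a. h a \<le> C"
  shows "sf_drift (density_ratio (density \<mu> (\<lambda>a. ennreal (h a)))) y t
    = (1 / (\<integral>a. h a \<partial>bridge_cond \<mu> u y)) *\<^sub>R (\<integral>a. h a *\<^sub>R ((1 / u) *\<^sub>R (a - y)) \<partial>bridge_cond \<mu> u y)"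
proof -
  let ?p = "bridge_density u" and ?X = "\<lambda>a. (1 / u) *\<^sub>R (a - y)" and ?H = "\<integral>a. bridge_density u y a \<partial>\<mu>"
  interpret \<mu>: prob_space \<mu> by (rule prob)
  have hC': "\<bar>h a\<bar> \<le> C" for a using assms(4)[of a] hC[of a] by simp
  define \<mu>' where "\<mu>' = density \<mu> (\<lambda>a. ennreal (h a))"
  have fin: "finite_measure \<mu>'"
  proof (rule finite_measureI)
    have "integrable \<mu> h" by (rule \<mu>.integrable_const_bound[where B=C]) (use hC' in auto)
    then have "(\<integral>\<^sup>+a. ennreal (h a) \<partial>\<mu>) \<noteq> \<infinity>"
      using assms(4) by (subst nn_integral_eq_integral) (auto simp: less_imp_le)
    then show "emeasure \<mu>' (space \<mu>') \<noteq> \<infinity>"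
      unfolding \<mu>'_def by (subst emeasure_density) (auto cong: nn_integral_cong_simp)
  qed
  have ac: "absolutely_continuous std_gaussian \<mu>'"
    using assms(1) absolutely_continuousI_density[of "\<lambda>a. ennreal (h a)" \<mu>]
    unfolding absolutely_continuous_def \<mu>'_def by auto
  define N where "N = (\<lambda>x. \<integral>a. h a * ?p x a \<partial>\<mu>)"
  have heat: "heat (1 - t) (density_ratio \<mu>') x = N x" for x
    unfolding t[symmetric] using assms(4)
    by (subst heat_density_ratio[OF fin _ ac u])
       (auto simp: \<mu>'_def sets N_def integral_density less_imp_le)
  have "0 < N y"
    unfolding N_def
    by (rule \<mu>.expectation_pos[OF integrable_bridge[OF sets u bei h hC']
          mult_pos_pos[OF assms(4) bridge_density_pos[OF u]]])
  have "GDERIV (\<lambda>x. ln (N x)) y :> (1 / N y) *\<^sub>R (\<integral>a. (h a * ?p y a) *\<^sub>R ?X a \<partial>\<mu>)"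
    using GDERIV_DERIV_compose[OF GDERIV_bridge_integral[OF sets u bei h hC'] DERIV_ln_divide]
      \<open>0 < N y\<close> by (simp add: N_def)
  then have "sf_drift (density_ratio \<mu>') y t = (1 / N y) *\<^sub>R (\<integral>a. (h a * ?p y a) *\<^sub>R ?X a \<partial>\<mu>)"
    unfolding sf_drift_def heat by (rule grad_eqI)
  \<comment> \<open>Numerator and denominator are both divided by the untilted normaliser, which
    turns integrals against \<open>\<mu>\<close> into means under
    \<open>bridge_cond\<close>.\<close>
  also have "\<dots> = (1 / ((1 / ?H) * N y)) *\<^sub>R ((1 / ?H) *\<^sub>R (\<integral>a. (h a * ?p y a) *\<^sub>R ?X a \<partial>\<mu>))"
    using bridge_integral_pos by simp
  also have "(1 / ?H) * N y = (\<integral>a. h a \<partial>bridge_cond \<mu> u y)"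
    by (subst integral_bridge_cond[OF sets u h]) (simp add: N_def mult.commute)
  also have "(1 / ?H) *\<^sub>R (\<integral>a. (h a * ?p y a) *\<^sub>R ?X a \<partial>\<mu>) = (\<integral>a. h a *\<^sub>R ?X a \<partial>bridge_cond \<mu> u y)"
    by (subst integral_bridge_cond[OF sets u]) (simp_all add: mult.commute)
  finally show ?thesis unfolding \<mu>'_def .
qed

end

section \<open>Joint law of the reference process and identification of its conditional laws\<close>

text \<open>The case n = 1 of the finite-dimensional densities, with the product over a single index
  identified with Lebesgue measure.\<close>

lemma brownian_bridge_law_marginal:
  fixes a :: "'a::euclidean_space"
  assumes K: "brownian_bridge_law a K" and t: "0 < t" "t < 1" and [measurable]: "B \<in> sets borel"
  shows "emeasure K {w \<in> space (path_space 1). w t \<in> B}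
    = (\<integral>\<^sup>+x. ennreal (gauss_density t x * bridge_density (1 - t) x a) * indicator B x \<partial>lborel)"
proof -
  have [measurable_cong]: "sets K = sets (path_space 1)" using K by (simp add: brownian_bridge_law_def)
  then have sp: "space K = space (path_space 1)" by (rule sets_eq_imp_space_eq)
  interpret product_sigma_finite "\<lambda>_::nat. lborel :: 'a measure"
    by standard
  let ?P = "PiM {1::nat} (\<lambda>_. lborel :: 'a measure)"
  \<comment> \<open>The single intermediate time t has index 1; index 0 is the start and index 2 the
    terminal time 1.\<close>
  define \<tau> :: "nat \<Rightarrow> real" where "\<tau> = (\<lambda>i. if i = 0 then 0 else if i = 1 then t else 1)"
  define d where "d = (\<lambda>x. ennreal (gauss_density t x * bridge_density (1 - t) x a))"
  have [measurable]: "d \<in> borel_measurable borel" by (simp add: d_def)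
  have "\<tau> 0 = 0 \<and> \<tau> (Suc 1) = 1 \<and> (\<forall>i\<le>1. \<tau> i < \<tau> (Suc i))"
    using t by (auto simp: \<tau>_def le_Suc_eq)
  then have "distributed K (PiM {1..1} (\<lambda>_. lborel)) (\<lambda>w. \<lambda>i\<in>{1..1}. w (\<tau> i))
      (\<lambda>x. let z = x(0 := 0, Suc 1 := a) in
         ennreal ((\<Prod>i\<le>1. gauss_density (\<tau> (Suc i) - \<tau> i) (z (Suc i) - z i)) / gauss_density 1 a))"
    using K unfolding brownian_bridge_law_def by blast
  then have D: "distributed K ?P (\<lambda>w. \<lambda>i\<in>{1}. w (\<tau> i)) (\<lambda>x. d (x 1))"
    by (simp add: \<tau>_def d_def bridge_density_def)
  define S where "S = {x \<in> space ?P. x 1 \<in> B}"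
  have S[measurable]: "S \<in> sets ?P" unfolding S_def by measurable
  have "emeasure K ((\<lambda>w. \<lambda>i\<in>{1}. w (\<tau> i)) -` S \<inter> space K) = (\<integral>\<^sup>+x. d (x 1) * indicator S x \<partial>?P)"
    by (rule distributed_emeasure[OF D S])
  also have "(\<lambda>w. \<lambda>i\<in>{1}. w (\<tau> i)) -` S \<inter> space K = {w \<in> space (path_space 1). w t \<in> B}"
    by (auto simp: S_def sp \<tau>_def space_PiM PiE_def)
  also have "(\<integral>\<^sup>+x. d (x 1) * indicator S x \<partial>?P) = (\<integral>\<^sup>+x. d (x 1) * indicator B (x 1) \<partial>?P)"
    by (intro nn_integral_cong) (auto simp: S_def indicator_def)
  also have "\<dots> = (\<integral>\<^sup>+x. d x * indicator B x \<partial>lborel)"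
    by (rule product_nn_integral_singleton) simp
  finally show ?thesis by (simp add: d_def)
qed

context
  fixes M :: "'w measure" and Y :: "real \<Rightarrow> 'w \<Rightarrow> 'a::euclidean_space" and \<mu> :: "'a measure"
  assumes ref: "reference_process M Y \<mu>"
begin

text \<open>Disintegration over the endpoint: given Y_1 = a the path is a bridge, whose position at
  time t has the density just computed. Tonelli then puts the integral over the position outside,
  the order required for conditioning on Y_t.\<close>

lemma reference_process_joint:
  assumes t: "0 < t" "t < 1" and B[measurable]: "B \<in> sets borel" and C[measurable]: "C \<in> sets borel"
  shows "emeasure M {w \<in> space M. Y t w \<in> B \<and> Y 1 w \<in> C}
    = (\<integral>\<^sup>+x. (\<integral>\<^sup>+a. ennreal (gauss_density t x * bridge_density (1 - t) x a) * indicator C a \<partial>\<mu>)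
         * indicator B x \<partial>lborel)"
proof -
  have "prob_space M" and Y: "\<And>t. t \<in> {0..1} \<Longrightarrow> Y t \<in> borel_measurable M"
    and \<mu>: "distr M borel (Y 1) = \<mu>"
    using ref by (auto simp: reference_process_def)
  interpret prob_space M by fact
  interpret \<mu>: prob_space \<mu> unfolding \<mu>[symmetric] by (rule prob_space_distr) (simp add: Y)
  have [measurable_cong]: "sets \<mu> = sets borel" unfolding \<mu>[symmetric] by simp
  obtain K where K: "regular_cond_dist M borel (path_space 1) (Y 1) (\<lambda>w. \<lambda>t\<in>{0..1}. Y t w) K"
    and bb: "AE a in \<mu>. brownian_bridge_law a (K a)"
    using ref by (auto simp: reference_process_def)
  have t01: "t \<in> {0..1}" using t by simp
  define S where "S = {\<omega> \<in> space (path_space 1). (\<omega> t :: 'a) \<in> B}"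
  have S: "S \<in> sets (path_space 1)" unfolding S_def using t01 by measurable
  have "{w \<in> space M. Y t w \<in> B \<and> Y 1 w \<in> C} = {w \<in> space M. Y 1 w \<in> C \<and> (\<lambda>t\<in>{0..1}. Y t w) \<in> S}"
    using t01 by (auto simp: S_def space_PiM)
  then have "emeasure M {w \<in> space M. Y t w \<in> B \<and> Y 1 w \<in> C}
      = (\<integral>\<^sup>+a. emeasure (K a) S * indicator C a \<partial>\<mu>)"
    using K S C by (simp add: regular_cond_dist_def \<mu>)
  also have "\<dots> = (\<integral>\<^sup>+a. (\<integral>\<^sup>+x. ennreal (gauss_density t x * bridge_density (1 - t) x a) * indicator B x \<partial>lborel)
      * indicator C a \<partial>\<mu>)"
    using bb by (intro nn_integral_cong_AE, eventually_elim)
      (simp add: S_def brownian_bridge_law_marginal[OF _ t B])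
  also have "\<dots> = (\<integral>\<^sup>+a. \<integral>\<^sup>+x. ennreal (gauss_density t x * bridge_density (1 - t) x a) * indicator B x
      * indicator C a \<partial>lborel \<partial>\<mu>)"
    by (simp add: nn_integral_multc)
  also have "\<dots> = (\<integral>\<^sup>+x. \<integral>\<^sup>+a. ennreal (gauss_density t x * bridge_density (1 - t) x a) * indicator B x
      * indicator C a \<partial>\<mu> \<partial>lborel)"
  proof (rule pair_sigma_finite.Fubini')
    show "pair_sigma_finite lborel \<mu>"
      by (simp add: pair_sigma_finite_def sigma_finite_lborel \<mu>.sigma_finite_measure_axioms)
  qed measurable
  also have "\<dots> = (\<integral>\<^sup>+x. (\<integral>\<^sup>+a. ennreal (gauss_density t x * bridge_density (1 - t) x a) * indicator C a \<partial>\<mu>)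
         * indicator B x \<partial>lborel)"
    by (intro nn_integral_cong, subst nn_integral_multc[symmetric]) (auto simp: ac_simps)
  finally show ?thesis .
qed

text \<open>Y_t has the Lebesgue density \<open>gauss_density t x * H x\<close>, which is positive
  everywhere, so every y lies in the support. Weak continuity at y follows from
  \<open>GDERIV_bridge_cond_integral\<close>, and the defining identity is Bayes' formula against
  the joint law.\<close>

lemma cond_law_reference_process:
  assumes t: "0 < t" "t < 1"
  shows "cond_law M (Y t) (Y 1) y = bridge_cond \<mu> (1 - t) y"
proof -
  let ?p = "bridge_density (1 - t)" and ?\<kappa> = "bridge_cond \<mu> (1 - t)"
  define H where "H = (\<lambda>x. \<integral>a. ?p x a \<partial>\<mu>)"
  have "prob_space M" and Y: "\<And>t. t \<in> {0..1} \<Longrightarrow> Y t \<in> borel_measurable M"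
    and \<mu>: "distr M borel (Y 1) = \<mu>"
    using ref by (auto simp: reference_process_def)
  interpret prob_space M by fact
  have [measurable]: "Y t \<in> borel_measurable M" using Y t by simp
  interpret \<mu>: prob_space \<mu> unfolding \<mu>[symmetric] by (rule prob_space_distr) (simp add: Y)
  have sets[measurable_cong]: "sets \<mu> = sets borel" unfolding \<mu>[symmetric] by simp
  have u: "0 < 1 - t" "1 - t < 1" using t by auto
  have bei: "bridge_exp_integrable \<mu> (1 - t) x" for x
    by (rule bridge_exp_integrable_interior[OF \<mu>.prob_space_axioms sets u])
  note std = \<mu>.prob_space_axioms sets u(1) bei
  have Hpos: "0 < H x" for x unfolding H_def by (rule bridge_integral_pos[OF std])
  note ppos = bridge_density_pos[OF u(1)] and gpos = gauss_density_pos[OF t(1), where 'a='a]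
  have [measurable]: "H \<in> borel_measurable borel"
    unfolding H_def by measurable
  have law: "distr M borel (Y t) = density lborel (\<lambda>x. ennreal (gauss_density t x * H x))"
  proof (rule measure_eqI)
    fix B assume "B \<in> sets (distr M borel (Y t))"
    then have B[measurable]: "B \<in> sets borel" by simp
    have "emeasure (distr M borel (Y t)) B = emeasure M {w \<in> space M. Y t w \<in> B \<and> Y 1 w \<in> UNIV}"
      by (auto simp: emeasure_distr intro!: arg_cong[where f="emeasure M"])
    also have "\<dots> = (\<integral>\<^sup>+x. (\<integral>\<^sup>+a. ennreal (gauss_density t x * ?p x a) \<partial>\<mu>) * indicator B x \<partial>lborel)"
      using reference_process_joint[OF t B, of UNIV] by simp
    also have "\<dots> = (\<integral>\<^sup>+x. ennreal (gauss_density t x * H x) * indicator B x \<partial>lborel)"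
    proof (intro nn_integral_cong arg_cong2[where f="(*)"] refl)
      fix x
      have "(\<integral>\<^sup>+a. ennreal (gauss_density t x * ?p x a) \<partial>\<mu>) = ennreal (\<integral>a. gauss_density t x * ?p x a \<partial>\<mu>)"
        using integrable_bridge_density[OF std] ppos gpos
        by (intro nn_integral_eq_integral) (auto intro!: AE_I2 mult_nonneg_nonneg intro: less_imp_le)
      then show "(\<integral>\<^sup>+a. ennreal (gauss_density t x * ?p x a) \<partial>\<mu>) = ennreal (gauss_density t x * H x)"
        by (simp add: H_def)
    qed
    finally show "emeasure (distr M borel (Y t)) B
        = emeasure (density lborel (\<lambda>x. ennreal (gauss_density t x * H x))) B"
      by (simp add: emeasure_density)
  qed simp
  have em: "emeasure (?\<kappa> x) C = (\<integral>\<^sup>+a. ennreal (?p x a / H x) * indicator C a \<partial>\<mu>)"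
    if "C \<in> sets borel" for x C
    unfolding bridge_cond_def H_def using that by (subst emeasure_density) (auto simp: sets)
  show ?thesis
  proof (rule cond_law_eqI[OF \<open>prob_space M\<close>])
    show "Y t \<in> borel_measurable M" by simp
    show "isCont (\<lambda>x. \<integral>a. g a \<partial>?\<kappa> x) y" if g: "continuous_on UNIV g" "bounded (range g)"
      for g :: "'a \<Rightarrow> real"
    proof -
      obtain C where "\<And>a. \<bar>g a\<bar> \<le> C" using g(2) by (auto simp: bounded_iff)
      from GDERIV_bridge_cond_integral[OF std borel_measurable_continuous_onI[OF g(1)] this]
      show ?thesis unfolding gderiv_def by (rule has_derivative_continuous)
    qed
    show "emeasure (distr M borel (Y t)) U \<noteq> 0" if U: "open U" "y \<in> U" for U
    proof
      have ne: "ennreal (gauss_density t x * H x) \<noteq> 0" for x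
        using mult_pos_pos[OF gpos Hpos, of x x] by (simp only: ennreal_eq_0_iff not_le)
      assume "emeasure (distr M borel (Y t)) U = 0"
      then have "AE x in lborel. ennreal (gauss_density t x * H x) * indicator U x = 0"
        unfolding law using U by (simp add: emeasure_density nn_integral_0_iff_AE)
      then have "AE x in lborel. x \<notin> U"
        by eventually_elim (use ne in \<open>auto simp: indicator_def split: if_splits\<close>)
      then have "U \<in> null_sets lborel"
        using U(1) by (subst (asm) AE_iff_measurable[of U]) (auto simp: null_sets_def)
      then have "negligible U" by (simp add: negligible_iff_null_sets null_sets_completionI)
      then show False using open_not_negligible U by blast
    qed
    have "?\<kappa> \<in> borel \<rightarrow>\<^sub>M prob_algebra borel"
    proof (intro measurable_prob_algebraI measurable_subprob_algebra)
      show "(\<lambda>x. emeasure (?\<kappa> x) C) \<in> borel_measurable borel" if "C \<in> sets borel" for C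
        unfolding em[OF that] using that by measurable
    qed (simp_all add: prob_space_bridge_cond[OF std] prob_space_imp_subprob_space sets)
    moreover have "emeasure M {w \<in> space M. Y t w \<in> B \<and> Y 1 w \<in> C}
        = (\<integral>\<^sup>+x. emeasure (?\<kappa> x) C * indicator B x \<partial>distr M borel (Y t))"
      if B: "B \<in> sets borel" and C: "C \<in> sets borel" for B C
    proof -
      note [measurable] = B C
      have "(\<integral>\<^sup>+x. emeasure (?\<kappa> x) C * indicator B x \<partial>distr M borel (Y t))
          = (\<integral>\<^sup>+x. ennreal (gauss_density t x * H x)
              * ((\<integral>\<^sup>+a. ennreal (?p x a / H x) * indicator C a \<partial>\<mu>) * indicator B x) \<partial>lborel)"
        unfolding law em[OF C] by (subst nn_integral_density) auto
      also have "\<dots> = (\<integral>\<^sup>+x. (\<integral>\<^sup>+a. ennreal (gauss_density t x * ?p x a) * indicator C a \<partial>\<mu>)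
          * indicator B x \<partial>lborel)"
      \<comment> \<open>The normaliser \<open>H x\<close> in the density of Y_t cancels the one
        inside the conditional law.\<close>
      proof (rule nn_integral_cong)
        fix x
        have "ennreal (gauss_density t x * H x) * ennreal (?p x a / H x) = ennreal (gauss_density t x * ?p x a)"
          for a
          using Hpos[of x] gpos[of x] ppos[of x a] by (subst ennreal_mult[symmetric]) auto
        then have "ennreal (gauss_density t x * H x) * (\<integral>\<^sup>+a. ennreal (?p x a / H x) * indicator C a \<partial>\<mu>)
            = (\<integral>\<^sup>+a. ennreal (gauss_density t x * ?p x a) * indicator C a \<partial>\<mu>)"
          by (subst nn_integral_cmult[symmetric]) (auto simp: mult.assoc[symmetric])
        then show "ennreal (gauss_density t x * H x)
              * ((\<integral>\<^sup>+a. ennreal (?p x a / H x) * indicator C a \<partial>\<mu>) * indicator B x)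
            = (\<integral>\<^sup>+a. ennreal (gauss_density t x * ?p x a) * indicator C a \<partial>\<mu>) * indicator B x"
          by (simp add: mult.assoc[symmetric])
      qed
      finally show ?thesis unfolding reference_process_joint[OF t B C] by simp
    qed
    ultimately show "regular_cond_dist M borel borel (Y t) (Y 1) ?\<kappa>"
      by (simp add: regular_cond_dist_def)
  qed
qed

text \<open>Since Y_0 = 0 almost surely, conditioning on it gives no information and the constant
  kernel \<open>\<mu>\<close> is a version. The point 0 is the whole support of the law of Y_0, so
  no other point could be treated.\<close>

lemma cond_law_reference_process_0: "cond_law M (Y 0) (Y 1) 0 = \<mu>"
proof -
  have "prob_space M" and Y: "\<And>t. t \<in> {0..1} \<Longrightarrow> Y t \<in> borel_measurable M"
    and \<mu>: "distr M borel (Y 1) = \<mu>" and Y0: "AE w in M. Y 0 w = 0"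
    using ref by (auto simp: reference_process_def sde_solution_def)
  interpret prob_space M by fact
  have [measurable]: "Y 0 \<in> borel_measurable M" "Y 1 \<in> borel_measurable M" using Y by simp_all
  have p\<mu>: "prob_space \<mu>" unfolding \<mu>[symmetric] by (rule prob_space_distr) simp
  have sets: "sets \<mu> = sets borel" unfolding \<mu>[symmetric] by simp
  have law: "distr M borel (Y 0) = return borel 0"
  proof -
    have "distr M borel (Y 0) = distr M borel (\<lambda>_. 0)" using Y0 by (intro distr_cong_AE) auto
    then show ?thesis by simp
  qed
  show ?thesis
  proof (rule cond_law_eqI[OF \<open>prob_space M\<close>, where \<kappa>="\<lambda>_. \<mu>"])
    show "emeasure (distr M borel (Y 0)) U \<noteq> 0" if "open U" "0 \<in> U" for U
      using that by (simp add: law)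
    have "emeasure M {w \<in> space M. Y 0 w \<in> B \<and> Y 1 w \<in> C} = emeasure \<mu> C * indicator B 0"
      if [measurable]: "B \<in> sets borel" "C \<in> sets borel" for B C
    proof -
      have "emeasure M {w \<in> space M. Y 0 w \<in> B \<and> Y 1 w \<in> C}
          = emeasure M {w \<in> space M. 0 \<in> B \<and> Y 1 w \<in> C}"
        using Y0 by (intro emeasure_eq_AE) auto
      also have "\<dots> = emeasure \<mu> C * indicator B 0"
        unfolding \<mu>[symmetric]
        by (auto simp: emeasure_distr indicator_def intro!: arg_cong[where f="emeasure M"])
      finally show ?thesis .
    qed
    moreover have "(\<lambda>_. \<mu>) \<in> borel \<rightarrow>\<^sub>M prob_algebra borel"
      using p\<mu> sets by (intro measurable_const) (simp add: space_prob_algebra)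
    ultimately show "regular_cond_dist M borel borel (Y 0) (Y 1) (\<lambda>_. \<mu>)"
      unfolding regular_cond_dist_def law by (simp add: nn_integral_return)
  qed simp_all
qed

end

section \<open>Expansion of the updated drift and conclusion\<close>

text \<open>The expansion of tilted means with \<epsilon> = 1 / lambda and X = (a - y) / u under the
  conditional law. The normaliser of the tilted policy cancels in the logarithmic derivative, so its
  dependence on lambda causes no error term.\<close>

lemma sf_drift_tilted_policy_expansion:
  fixes \<mu> :: "'a::euclidean_space measure" and A :: "'a \<Rightarrow> real"
  assumes prob: "prob_space \<mu>" and sets[measurable_cong]: "sets \<mu> = sets borel"
    and ac: "absolutely_continuous std_gaussian \<mu>"
    and A[measurable]: "A \<in> borel_measurable borel" and AC: "\<And>a. \<bar>A a\<bar> \<le> C"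
    and "t < 1" and bei: "bridge_exp_integrable \<mu> (1 - t) y"
  shows "(\<lambda>lam. norm (sf_drift (density_ratio (tilted_policy \<mu> A lam)) y t
            - sf_drift (density_ratio \<mu>) y t
            - (1 / (lam * (1 - t))) *\<^sub>R cov_id (bridge_cond \<mu> (1 - t) y) A))
          \<in> O[at_top](\<lambda>lam. 1 / lam\<^sup>2)"
proof -
  define u where "u = 1 - t"
  have u: "0 < u" "u = 1 - t" using \<open>t < 1\<close> by (simp_all add: u_def)
  note std = prob sets u(1) bei[folded u_def]
  let ?\<nu> = "bridge_cond \<mu> u y" and ?X = "\<lambda>a. (1 / u) *\<^sub>R (a - y)"
  interpret \<mu>: prob_space \<mu> by (rule prob)
  interpret \<nu>: prob_space ?\<nu> by (rule prob_space_bridge_cond[OF std])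
  have id: "integrable ?\<nu> (\<lambda>a. a)" by (rule integrable_bridge_cond_id[OF std])
  then have iX: "integrable ?\<nu> ?X" by simp
  define x where "x = (\<integral>a. ?X a \<partial>?\<nu>)"
  have drift0: "sf_drift (density_ratio \<mu>) y t = x"
    using sf_drift_density[OF std ac u(2), of "\<lambda>_. 1" 1]
    by (simp add: density_1 x_def \<nu>.prob_space)
  have drift: "sf_drift (density_ratio (tilted_policy \<mu> A lam)) y t
      = (1 / (\<integral>a. exp (1 / lam * A a) \<partial>?\<nu>)) *\<^sub>R (\<integral>a. exp (1 / lam * A a) *\<^sub>R ?X a \<partial>?\<nu>)"
    if "0 < lam" for lam
  proof -
    define Z where "Z = (\<integral>a'. exp (A a' / lam) \<partial>\<mu>)"
    have eb: "exp (A a / lam) \<le> exp (C / lam)" for a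
      using AC[of a] \<open>0 < lam\<close> by (simp add: divide_right_mono abs_le_iff)
    have "integrable \<mu> (\<lambda>a. exp (A a / lam))"
      by (rule \<mu>.integrable_const_bound[where B="exp (C / lam)"]) (use eb in auto)
    then have "0 < Z" unfolding Z_def by (rule \<mu>.expectation_pos) simp
    have "sf_drift (density_ratio (tilted_policy \<mu> A lam)) y t
        = (1 / (\<integral>a. exp (A a / lam) / Z \<partial>?\<nu>)) *\<^sub>R (\<integral>a. (exp (A a / lam) / Z) *\<^sub>R ?X a \<partial>?\<nu>)"
      unfolding tilted_policy_def Z_def[symmetric]
      by (rule sf_drift_density[OF std ac u(2), where C="exp (C / lam) / Z"])
         (use \<open>0 < Z\<close> eb in \<open>auto simp: divide_right_mono\<close>)
    also have "(\<integral>a. (exp (A a / lam) / Z) *\<^sub>R ?X a \<partial>?\<nu>)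
        = (1 / Z) *\<^sub>R (\<integral>a. exp (A a / lam) *\<^sub>R ?X a \<partial>?\<nu>)"
      by (subst integral_scaleR_right[symmetric]) (simp add: mult.commute)
    finally show ?thesis using \<open>0 < Z\<close> by simp
  qed
  have cov: "(\<integral>a. (A a - \<nu>.expectation A) *\<^sub>R (?X a - x) \<partial>?\<nu>) = (1 / u) *\<^sub>R cov_id ?\<nu> A"
  proof -
    have "x = (1 / u) *\<^sub>R ((\<integral>a. a \<partial>?\<nu>) - y)" using id by (simp add: x_def \<nu>.prob_space)
    then have "(A a - \<nu>.expectation A) *\<^sub>R (?X a - x)
        = (1 / u) *\<^sub>R ((A a - \<nu>.expectation A) *\<^sub>R (a - (\<integral>a. a \<partial>?\<nu>)))" for a
      by (simp add: algebra_simps)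
    then show ?thesis by (simp add: cov_id_def del: scaleR_scaleR)
  qed
  have "A \<in> borel_measurable ?\<nu>" by measurable
  from \<nu>.tilt_expansion[OF this iX AC] obtain K where K: "\<And>\<epsilon>. 0 < \<epsilon> \<Longrightarrow> \<epsilon> \<le> 1 \<Longrightarrow>
    norm ((1 / (\<integral>a. exp (\<epsilon> * A a) \<partial>?\<nu>)) *\<^sub>R (\<integral>a. exp (\<epsilon> * A a) *\<^sub>R ?X a \<partial>?\<nu>) - x
           - \<epsilon> *\<^sub>R (\<integral>a. (A a - \<nu>.expectation A) *\<^sub>R (?X a - x) \<partial>?\<nu>)) \<le> K * \<epsilon>\<^sup>2"
    unfolding x_def by blast
  show ?thesis
  \<comment> \<open>The big-O constant has to be positive, which \<open>K\<close> need not be. The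
    range lambda >= 1 corresponds to \<epsilon> <= 1.\<close>
  proof (rule landau_o.bigI[where c="max K 1"])
    show "\<forall>\<^sub>F lam in at_top. norm (norm (sf_drift (density_ratio (tilted_policy \<mu> A lam)) y t
            - sf_drift (density_ratio \<mu>) y t - (1 / (lam * (1 - t))) *\<^sub>R cov_id (bridge_cond \<mu> (1 - t) y) A))
          \<le> max K 1 * norm (1 / lam\<^sup>2)"
      using eventually_ge_at_top[of "1::real"]
    proof eventually_elim
      case (elim lam)
      then have "0 < 1 / lam" "1 / lam \<le> 1" by simp_all
      from K[OF this] \<open>1 \<le> lam\<close>
      have "norm (sf_drift (density_ratio (tilted_policy \<mu> A lam)) y t - sf_drift (density_ratio \<mu>) y t
          - (1 / (lam * u)) *\<^sub>R cov_id ?\<nu> A) \<le> K * (1 / lam\<^sup>2)"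
        unfolding cov by (simp add: drift drift0 power_inverse divide_inverse)
      also have "\<dots> \<le> max K 1 * (1 / lam\<^sup>2)" by (intro mult_right_mono) auto
      finally show ?case by (simp add: u_def)
    qed
  qed simp
qed

theorem propositionA2:
  fixes \<pi> :: "nat \<Rightarrow> 's \<Rightarrow> 'a::euclidean_space measure"
    and A :: "nat \<Rightarrow> 's \<Rightarrow> 'a \<Rightarrow> real"
    and k :: nat and s :: 's
    and M :: "'w measure" and Y :: "real \<Rightarrow> 'w \<Rightarrow> 'a"
    and t :: real and y :: 'a
  defines "f \<equiv> density_ratio (\<pi> k s)"
    and "fbar \<equiv> (\<lambda>lam. density_ratio (tilted_policy (\<pi> k s) (A k s) lam))"
    and "\<nu> \<equiv> cond_law M (Y t) (Y 1)"
  assumes "prob_space (\<pi> k s)"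
    and "sets (\<pi> k s) = sets borel"
    and "absolutely_continuous std_gaussian (\<pi> k s)"
    and "A k s \<in> borel_measurable borel"
    and "bounded (range (A k s))"
    and "reference_process M Y (\<pi> k s)"
    and "0 \<le> t" and "t < 1"
    and "integrable (\<nu> y) (\<lambda>a. a)"
    and "integrable (\<nu> y) (A k s)"
    and "integrable (\<nu> y) (\<lambda>a. A k s a *\<^sub>R a)"
    and "t = 0 \<Longrightarrow> y = 0 \<and> (\<forall>\<^sub>F x in nhds y. integrable std_gaussian (\<lambda>z. f (x + sqrt (1 - t) *\<^sub>R z)))"
  shows "(\<lambda>lam. norm (sf_drift (fbar lam) y t - sf_drift f y t
                       - (1 / (lam * (1 - t))) *\<^sub>R cov_id (\<nu> y) (A k s)))
           \<in> O[at_top](\<lambda>lam. 1 / lam\<^sup>2)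
       \<and> (0 < t \<and> (\<lambda>x. \<integral>a. A k s a \<partial>\<nu> x) differentiable (at y)
          \<longrightarrow> (\<lambda>lam. norm (sf_drift (fbar lam) y t - sf_drift f y t
                       - (1 / lam) *\<^sub>R grad (\<lambda>x. \<integral>a. A k s a \<partial>\<nu> x) y))
                \<in> O[at_top](\<lambda>lam. 1 / lam\<^sup>2))"
proof -
  define \<mu> where "\<mu> = \<pi> k s"
  note \<mu> = assms(4-6)[folded \<mu>_def]
  note ref = assms(9)[folded \<mu>_def]
  obtain C where C: "\<And>a. \<bar>A k s a\<bar> \<le> C" using assms(8) by (auto simp: bounded_iff)
  have fin: "finite_measure \<mu>" using \<mu>(1) by (simp add: prob_space_def)
  have "bridge_exp_integrable \<mu> (1 - t) y \<and> \<nu> y = bridge_cond \<mu> (1 - t) y"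
  \<comment> \<open>At t = 0 both ingredients have another source: the moment comes from local
    integrability of the heat integral, and the conditional law at the degenerate point 0 is
    \<open>\<mu>\<close>.\<close>
  proof (cases "t = 0")
    case True
    with assms(15) have y: "y = 0"
      and "\<forall>\<^sub>F x in nhds y. integrable std_gaussian (\<lambda>z. f (x + sqrt (1 - t) *\<^sub>R z))" by blast+
    with True have ev: "\<forall>\<^sub>F x in nhds 0. integrable std_gaussian (\<lambda>z. f (x + sqrt 1 *\<^sub>R z))" by simp
    have "\<forall>\<^sub>F x in nhds 0. integrable \<mu> (bridge_density 1 x)"
      using ev unfolding f_def \<mu>_def[symmetric] integrable_heat_density_ratio_iff[OF fin \<mu>(2,3) zero_less_one] .
    then have bei: "bridge_exp_integrable \<mu> 1 0" by (rule bridge_exp_integrable_origin[OF \<mu>(2)])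
    \<comment> \<open>The kernel is constantly 1 here and \<open>\<mu>\<close> has mass 1, so
      \<open>bridge_cond\<close> reduces to \<open>\<mu>\<close> and the general expansion also
      covers t = 0.\<close>
    have "bridge_density 1 0 a = 1" for a :: 'a
      using gauss_density_pos[of 1 a] by (simp add: bridge_density_def)
    then have "bridge_cond \<mu> 1 0 = \<mu>"
      using prob_space.prob_space[OF \<mu>(1)] by (simp add: bridge_cond_def density_1)
    then show ?thesis using bei True y cond_law_reference_process_0[OF ref] by (simp add: \<nu>_def)
  next
    case False
    with assms(10) have "0 < t" by simp
    with assms(11) show ?thesis
      using bridge_exp_integrable_interior[OF \<mu>(1,2), of "1 - t" y] cond_law_reference_process[OF ref, of t y]
      by (simp add: \<nu>_def)
  qed
  then have bei: "bridge_exp_integrable \<mu> (1 - t) y" and \<nu>y: "\<nu> y = bridge_cond \<mu> (1 - t) y" by auto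
  have expansion: "(\<lambda>lam. norm (sf_drift (fbar lam) y t - sf_drift f y t
          - (1 / (lam * (1 - t))) *\<^sub>R cov_id (\<nu> y) (A k s))) \<in> O[at_top](\<lambda>lam. 1 / lam\<^sup>2)"
    using sf_drift_tilted_policy_expansion[OF \<mu> assms(7) C assms(11) bei]
    by (simp add: fbar_def f_def \<mu>_def \<nu>y)
  \<comment> \<open>A gradient needs the conditional law at all x near y, and for t > 0 it is
    identified at every x. Once the gradient is this multiple of the covariance, the second
    expansion is the first one rewritten.\<close>
  moreover have "grad (\<lambda>x. \<integral>a. A k s a \<partial>\<nu> x) y = (1 / (1 - t)) *\<^sub>R cov_id (\<nu> y) (A k s)" if "0 < t"
  proof (rule grad_eqI)
    have "\<nu> x = bridge_cond \<mu> (1 - t) x" for x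
      using cond_law_reference_process[OF ref that assms(11)] by (simp add: \<nu>_def)
    then show "GDERIV (\<lambda>x. \<integral>a. A k s a \<partial>\<nu> x) y :> (1 / (1 - t)) *\<^sub>R cov_id (\<nu> y) (A k s)"
      using GDERIV_bridge_cond_integral[OF \<mu>(1,2) _ bei assms(7) C] assms(11) by simp
  qed
  ultimately show ?thesis by simp
qed

end
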